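(* Let $\mu$ be the uniform distribution on $\{0,1\}^k$ and let $0\le\epsilon<\frac12$ be fixed. For any protocol $\pi$ that $\epsilon$-computes $\mathsf{Par}_k$, $\mathsf{MIC}_\mu(\pi)=\Omega(k)$, where the implicit constant may depend on $\epsilon$ but not on $k$ or $\pi$.
   Context: Model (asynchronous number-in-hand peer-to-peer model). There are $k$ players. Player $i$ receives an input bit $x_i$, has a private random string $R_i$, and all players share a public random string $R^p$; the input $X\sim\mu$ is independent of the randomness. Every pair of players is joined by a bidirectional link with finite but unbounded delivery time and FIFO order in each direction. The view of player $i$ consists of $x_i$, $R_i$, $R^p$ and the messages read so far. A protocol specifies, for each player $i$ and each local round $\ell\ge1$, functions of the view of player $i$ at the end of local round $\ell-1$ giving: a set of recipients and, for each recipient $j$, a self-delimiting message in $\{0,1\}^*$ sent by $i$ to $j$; a value in $\{0,1\}^*\cup\{\bot\}$ — if not $\bot$, player $i$ stops and outputs it; otherwise a set of players from each of which player $i$ then waits to read one complete message, ending the local round. $\Pi_{i,j}^s$ is the sequence of messages sent by $i$ to $j$, $\Pi_{i,j}^r$ the sequence of messages read by $i$ from $j$, $\Pi_i=(\Pi_{i,j}^s,\Pi_{i,j}^r)_{j\ne i}$. $\mathsf{Par}_k(x)=x_1\oplus\cdots\oplus x_k$ must be output by player $1$; $\pi$ $\epsilon$-computes it if on every input and randomness every player eventually stops, and on every input with probability $\ge1-\epsilon$ player $1$ outputs $\mathsf{Par}_k(x)$. Multi-party information cost: $$\mathsf{MIC}_\mu(\pi)=\sum_{i=1}^k\big(I(X_{-i};\Pi_i\mid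 X_iR_i)+I(X_i;\Pi_i\mid X_{-i}R_{-i})\big).$$
   Formalization: Both mutual informations in MIC are conditioned on the public random string R^p too; with only X_i R_i and X_{-i} R_{-i} the claim fails, since players can mask their bits with public random bits, giving MIC = 0. The bound is stated for all k ≥ 2. *)

theory Defs
  imports "HOL-Probability.Probability"
begin

text \<open>
  Asynchronous number-in-hand peer-to-peer protocols for the players \<open>1, \<dots>, k\<close>.  A message is one
  unit of communication: a read always returns exactly one complete message, which is what
  self-delimitation of the messages provides.
\<close>

type_synonym msg = "bool list"

text \<open>
  Random strings are infinite bit strings.  Their distributions are arbitrary probability spaces
  whose carrier is the set of possible strings; finite strings are covered by padding.
\<close>

type_synonym rstr = "bool stream"

text \<open>
  The component \<open>reads\<close> of a view gives, for every sender, the messages read from it so far.  The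
  rounds in which they were read can be reconstructed by replaying the player's own waiting sets.
\<close>

record view =
  inp :: bool
  priv_str :: rstr
  pub_str :: rstr
  reads :: "nat \<Rightarrow> msg list"

text \<open>
  The functions take the player \<open>i\<close>, the local round \<open>l \<ge> 1\<close> and the view of \<open>i\<close> at the end of local
  round \<open>l - 1\<close>.  The recipients are the \<open>j\<close> with \<open>send \<pi> i l v j \<noteq> None\<close>, and \<open>out \<pi> i l v = None\<close>
  stands for \<open>\<bottom>\<close>.
\<close>

record protocol =
  priv :: "nat \<Rightarrow> rstr measure"
  pub :: "rstr measure"
  send :: "nat \<Rightarrow> nat \<Rightarrow> view \<Rightarrow> nat \<Rightarrow> msg option"
  out :: "nat \<Rightarrow> nat \<Rightarrow> view \<Rightarrow> msg option"
  wait :: "nat \<Rightarrow> nat \<Rightarrow> view \<Rightarrow> nat set"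

definition is_protocol :: "nat \<Rightarrow> protocol \<Rightarrow> bool" where
  "is_protocol k \<pi> \<longleftrightarrow>
     prob_space (pub \<pi>) \<and>
     (\<forall>i\<in>{1..k}. prob_space (priv \<pi> i)) \<and>
     (\<forall>i\<in>{1..k}. \<forall>l\<ge>1. \<forall>v.
        {j. send \<pi> i l v j \<noteq> None} \<subseteq> {1..k} - {i} \<and> wait \<pi> i l v \<subseteq> {1..k} - {i}) \<and>
     (\<forall>i\<in>{1..k}. \<forall>l\<ge>1. \<forall>b h.
        (\<forall>j. (\<lambda>(s, p). send \<pi> i l \<lparr>inp = b, priv_str = s, pub_str = p, reads = h\<rparr> j)
               \<in> priv \<pi> i \<Otimes>\<^sub>M pub \<pi> \<rightarrow>\<^sub>M count_space UNIV) \<and>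
        (\<lambda>(s, p). out \<pi> i l \<lparr>inp = b, priv_str = s, pub_str = p, reads = h\<rparr>)
               \<in> priv \<pi> i \<Otimes>\<^sub>M pub \<pi> \<rightarrow>\<^sub>M count_space UNIV \<and>
        (\<lambda>(s, p). wait \<pi> i l \<lparr>inp = b, priv_str = s, pub_str = p, reads = h\<rparr>)
               \<in> priv \<pi> i \<Otimes>\<^sub>M pub \<pi> \<rightarrow>\<^sub>M count_space UNIV)"


section \<open>Executions\<close>

datatype status = Ready | Waiting "nat set" | Stopped msg

text \<open>
  \<open>rnd\<close> is the number of completed local rounds; for player \<open>i\<close>, \<open>sent j\<close> lists the messages sent by
  \<open>i\<close> to \<open>j\<close>, and \<open>rcvd j\<close> those read by \<open>i\<close> from \<open>j\<close>.
\<close>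

record pstate =
  rnd :: nat
  status :: status
  sent :: "nat \<Rightarrow> msg list"
  rcvd :: "nat \<Rightarrow> msg list"

type_synonym conf = "nat \<Rightarrow> pstate"

definition init_conf :: conf where
  "init_conf = (\<lambda>i. \<lparr>rnd = 0, status = Ready, sent = (\<lambda>j. []), rcvd = (\<lambda>j. [])\<rparr>)"

text \<open>
  The messages in transit from \<open>j\<close> to \<open>i\<close> are those of \<open>sent (c j) i\<close> beyond the first
  \<open>length (rcvd (c i) j)\<close> ones; they are read in FIFO order.  There is no separate delivery event: a
  message sits on its link until the recipient moves, which may happen arbitrarily late.
\<close>

definition enabled :: "conf \<Rightarrow> nat \<Rightarrow> bool" where
  "enabled c i =
     (case status (c i) of
        Ready \<Rightarrow> True
      | Waiting W \<Rightarrow> \<forall>j\<in>W. length (rcvd (c i) j) < length (sent (c j) i)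
      | Stopped w \<Rightarrow> False)"

definition advance ::
  "protocol \<Rightarrow> (nat \<Rightarrow> bool) \<Rightarrow> (nat \<Rightarrow> rstr) \<Rightarrow> rstr \<Rightarrow> conf \<Rightarrow> nat \<Rightarrow> pstate" where
  "advance \<pi> x r p c i =
     (let s = c i; l = Suc (rnd s);
          v = \<lparr>inp = x i, priv_str = r i, pub_str = p, reads = rcvd s\<rparr>
      in case status s of
        Ready \<Rightarrow>
          s\<lparr>status := (case out \<pi> i l v of Some w \<Rightarrow> Stopped w | None \<Rightarrow> Waiting (wait \<pi> i l v)),
            sent := (\<lambda>j. sent s j @ (case send \<pi> i l v j of Some m \<Rightarrow> [m] | None \<Rightarrow> []))\<rparr>
      | Waiting W \<Rightarrow>
          s\<lparr>rnd := l, status := Ready,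
            rcvd := (\<lambda>j. if j \<in> W then rcvd s j @ [sent (c j) i ! length (rcvd s j)] else rcvd s j)\<rparr>
      | Stopped w \<Rightarrow> s)"

definition execution ::
  "nat \<Rightarrow> protocol \<Rightarrow> (nat \<Rightarrow> bool) \<Rightarrow> (nat \<Rightarrow> rstr) \<Rightarrow> rstr \<Rightarrow> (nat \<Rightarrow> conf) \<Rightarrow> bool" where
  "execution k \<pi> x r p f \<longleftrightarrow>
     f 0 = init_conf \<and>
     (\<forall>n. f (Suc n) = f n \<or>
          (\<exists>i\<in>{1..k}. enabled (f n) i \<and> f (Suc n) = (f n)(i := advance \<pi> x r p (f n) i)))"

text \<open>Fairness expresses that delays are finite: a player that can move eventually does.\<close>

definition fair :: "nat \<Rightarrow> (nat \<Rightarrow> conf) \<Rightarrow> bool" where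
  "fair k f \<longleftrightarrow> (\<forall>i\<in>{1..k}. \<forall>n. enabled (f n) i \<longrightarrow> (\<exists>m\<ge>n. f (Suc m) i \<noteq> f m i))"

definition stopped :: "pstate \<Rightarrow> bool" where
  "stopped s \<longleftrightarrow> (\<exists>w. status s = Stopped w)"

definition always_stops :: "nat \<Rightarrow> protocol \<Rightarrow> (nat \<Rightarrow> bool) \<Rightarrow> (nat \<Rightarrow> rstr) \<Rightarrow> rstr \<Rightarrow> bool" where
  "always_stops k \<pi> x r p \<longleftrightarrow>
     (\<forall>f. execution k \<pi> x r p f \<and> fair k f \<longrightarrow> (\<forall>i\<in>{1..k}. \<exists>n. stopped (f n i)))"

definition final_conf ::
  "nat \<Rightarrow> protocol \<Rightarrow> (nat \<Rightarrow> bool) \<Rightarrow> (nat \<Rightarrow> rstr) \<Rightarrow> rstr \<Rightarrow> conf \<Rightarrow> bool" where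
  "final_conf k \<pi> x r p c \<longleftrightarrow>
     (\<exists>f n. execution k \<pi> x r p f \<and> f n = c \<and> (\<forall>i\<in>{1..k}. stopped (c i)))"

text \<open>
  The final configuration does not depend on the delays (\<open>final_conf_unique\<close> below), so that
  transcripts and outputs are functions of the inputs and the random strings.
\<close>

definition outcome :: "nat \<Rightarrow> protocol \<Rightarrow> (nat \<Rightarrow> bool) \<Rightarrow> (nat \<Rightarrow> rstr) \<Rightarrow> rstr \<Rightarrow> conf" where
  "outcome k \<pi> x r p = (THE c. final_conf k \<pi> x r p c)"

lemma execution_move:
  assumes "execution k \<pi> x r p f" "f (Suc n) i \<noteq> f n i"
  shows "i \<in> {1..k} \<and> enabled (f n) i \<and> f (Suc n) i = advance \<pi> x r p (f n) i"
proof -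
  have "f (Suc n) \<noteq> f n" using assms(2) by auto
  then obtain i' where "i' \<in> {1..k}" "enabled (f n) i'"
    "f (Suc n) = (f n)(i' := advance \<pi> x r p (f n) i')"
    using assms(1) unfolding execution_def by blast
  with assms(2) show ?thesis by (cases "i' = i") auto
qed

lemma execution_sent_mono:
  assumes "execution k \<pi> x r p f" "m \<le> n"
  shows "\<exists>ys. sent (f n i) j = sent (f m i) j @ ys"
  using assms(2)
proof (induction n rule: dec_induct)
  case base
  show ?case by simp
next
  case (step n)
  have "\<exists>ys. sent (f (Suc n) i) j = sent (f n i) j @ ys"
  proof (cases "f (Suc n) i = f n i")
    case True
    then show ?thesis by simp
  next
    case False
    then have "f (Suc n) i = advance \<pi> x r p (f n) i"
      using execution_move[OF assms(1)] by blast
    then show ?thesis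
      by (auto simp: advance_def Let_def split: status.splits)
  qed
  with step.IH show ?case by auto
qed

lemma execution_nth_sent:
  assumes "execution k \<pi> x r p f"
    and "a < length (sent (f m i) j)" "a < length (sent (f n i) j)"
  shows "sent (f m i) j ! a = sent (f n i) j ! a"
proof (cases "m \<le> n")
  case True
  then show ?thesis
    using execution_sent_mono[OF assms(1) True, of i j] assms(2) by (auto simp: nth_append)
next
  case False
  then show ?thesis
    using execution_sent_mono[OF assms(1), of n m i j] assms(3) by (auto simp: nth_append)
qed

lemma execution_stopped:
  assumes "execution k \<pi> x r p f" "stopped (f m i)" "m \<le> n"
  shows "f n i = f m i"
  using assms(3)
proof (induction n rule: dec_induct)
  case (step n)
  then have "\<not> enabled (f n) i"
    using assms(2) by (auto simp: enabled_def stopped_def)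
  then show ?case
    using execution_move[OF assms(1), of n i] step.IH by auto
qed simp

lemma advance_cong:
  assumes "c i = d i" "enabled c i" "enabled d i"
    and "\<And>j a. a < length (sent (c j) i) \<Longrightarrow> a < length (sent (d j) i) \<Longrightarrow>
           sent (c j) i ! a = sent (d j) i ! a"
  shows "advance \<pi> x r p c i = advance \<pi> x r p d i"
  using assms by (cases "status (d i)") (auto simp: advance_def enabled_def Let_def fun_eq_iff)

lemma execution_local_states:
  assumes f: "execution k \<pi> x r p f" and stop: "\<And>i. i \<in> {1..k} \<Longrightarrow> stopped (f N i)"
    and g: "execution k \<pi> x r p g"
  shows "\<exists>m. f m i = g n i"
proof (induction n arbitrary: i)
  case 0
  have "f 0 i = g 0 i" using f g by (simp add: execution_def)
  then show ?case by blast
next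
  case (Suc n)
  show ?case
  proof (cases "g (Suc n) i = g n i")
    case True
    then show ?thesis using Suc.IH[of i] by auto
  next
    case False
    note mv = execution_move[OF g False]
    obtain m where m: "f m i = g n i" using Suc.IH by blast
    have "\<not> stopped (g n i)"
      using mv by (auto simp: enabled_def stopped_def)
    moreover have "stopped (f (max m N) i)"
      using execution_stopped[OF f stop, of i "max m N"] stop mv by auto
    ultimately have ne: "f (max m N) i \<noteq> f m i" using m by metis
    define q where "q = (LEAST q. m \<le> q \<and> f (Suc q) i \<noteq> f q i)"
    have "\<exists>q. m \<le> q \<and> f (Suc q) i \<noteq> f q i"
    proof (rule ccontr)
      assume const: "\<not> ?thesis"
      have "f q i = f m i" if "m \<le> q" for q
        using that by (induction q rule: dec_induct) (use const in auto)
      then show False using ne by (meson max.cobounded1)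
    qed
    then have q: "m \<le> q" "f (Suc q) i \<noteq> f q i"
      unfolding q_def by (rule LeastI2_ex, simp)+
    have qmin: "f (Suc t) i = f t i" if "m \<le> t" "t < q" for t
      using not_less_Least[of t "\<lambda>q. m \<le> q \<and> f (Suc q) i \<noteq> f q i"] that q_def by auto
    have "f t i = f m i" if "m \<le> t" "t \<le> q" for t
      using that by (induction t rule: dec_induct) (auto simp: qmin)
    then have fq: "f q i = g n i" using q m by auto
    note mv' = execution_move[OF f q(2)]
    have "advance \<pi> x r p (f q) i = advance \<pi> x r p (g n) i"
    proof (rule advance_cong)
      fix j a
      assume a: "a < length (sent (f q j) i)" "a < length (sent (g n j) i)"
      obtain t where "f t j = g n j" using Suc.IH by blast
      then show "sent (f q j) i ! a = sent (g n j) i ! a"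
        using execution_nth_sent[OF f a(1), of t] a(2) by simp
    qed (use fq mv mv' in auto)
    then show ?thesis using mv mv' by metis
  qed
qed

lemma final_conf_unique:
  assumes "final_conf k \<pi> x r p c" "final_conf k \<pi> x r p d"
  shows "c = d"
proof
  fix i
  obtain f n where f: "execution k \<pi> x r p f" "f n = c" "\<And>i. i \<in> {1..k} \<Longrightarrow> stopped (f n i)"
    using assms(1) unfolding final_conf_def by blast
  obtain g m where g: "execution k \<pi> x r p g" "g m = d" "\<And>i. i \<in> {1..k} \<Longrightarrow> stopped (g m i)"
    using assms(2) unfolding final_conf_def by blast
  show "c i = d i"
  proof (cases "i \<in> {1..k}")
    case True
    obtain t where t: "f t i = d i"
      using execution_local_states[OF f(1) f(3) g(1)] g(2) by blast
    have "f t i = f n i"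
      using execution_stopped[OF f(1), of t i n] execution_stopped[OF f(1), of n i t]
        f(3)[OF True] g(3)[OF True] g(2) t by (metis nle_le)
    then show ?thesis using t f(2) by simp
  next
    case False
    have "h t i = init_conf i" if h: "execution k \<pi> x r p h" for h t
    proof (induction t)
      case 0
      show ?case using h by (simp add: execution_def)
    next
      case (Suc t)
      then show ?case using execution_move[OF h, of t i] False by auto
    qed
    from this[OF f(1), of n] this[OF g(1), of m] show ?thesis using f(2) g(2) by simp
  qed
qed


section \<open>Computing parity\<close>

primrec Par :: "nat \<Rightarrow> (nat \<Rightarrow> bool) \<Rightarrow> bool" where
  "Par 0 x = False"
| "Par (Suc k) x = (Par k x \<noteq> x (Suc k))"

definition inputs :: "nat \<Rightarrow> (nat \<Rightarrow> bool) set" where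
  "inputs k = ({1..k} \<rightarrow>\<^sub>E UNIV)"

definition randomness :: "nat \<Rightarrow> protocol \<Rightarrow> ((nat \<Rightarrow> rstr) \<times> rstr) measure" where
  "randomness k \<pi> = (\<Pi>\<^sub>M i\<in>{1..k}. priv \<pi> i) \<Otimes>\<^sub>M pub \<pi>"

definition eps_computes_Par :: "nat \<Rightarrow> real \<Rightarrow> protocol \<Rightarrow> bool" where
  "eps_computes_Par k \<epsilon> \<pi> \<longleftrightarrow>
     (\<forall>x\<in>inputs k. \<forall>(r, p)\<in>space (randomness k \<pi>). always_stops k \<pi> x r p) \<and>
     (\<forall>x\<in>inputs k.
        measure (randomness k \<pi>)
          {(r, p)\<in>space (randomness k \<pi>). status (outcome k \<pi> x r p 1) = Stopped [Par k x]}
        \<ge> 1 - \<epsilon>)"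


section \<open>Multi-party information cost\<close>

type_synonym sample = "(nat \<Rightarrow> bool) \<times> (nat \<Rightarrow> rstr) \<times> rstr"

definition sample_space :: "nat \<Rightarrow> protocol \<Rightarrow> (nat \<Rightarrow> bool) pmf \<Rightarrow> sample measure" where
  "sample_space k \<pi> \<mu> = measure_pmf \<mu> \<Otimes>\<^sub>M randomness k \<pi>"

definition transcript :: "nat \<Rightarrow> protocol \<Rightarrow> nat \<Rightarrow> sample \<Rightarrow> nat \<Rightarrow> msg list \<times> msg list" where
  "transcript k \<pi> i = (\<lambda>(x, r, p). \<lambda>j\<in>{1..k} - {i}.
     (sent (outcome k \<pi> x r p i) j, rcvd (outcome k \<pi> x r p i) j))"

definition transcript_space :: "nat \<Rightarrow> nat \<Rightarrow> (nat \<Rightarrow> msg list \<times> msg list) measure" where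
  "transcript_space k i = (\<Pi>\<^sub>M j\<in>{1..k} - {i}. count_space UNIV)"

text \<open>
  The mutual informations are conditioned on the public random string as well: it is known to all
  players, and part of what is given on both sides.  (Without this, messages masked by public random
  bits would carry no information, and every function could be computed at cost 0.)
\<close>

definition MIC :: "nat \<Rightarrow> (nat \<Rightarrow> bool) pmf \<Rightarrow> protocol \<Rightarrow> real" where
  "MIC k \<mu> \<pi> =
     (\<Sum>i\<in>{1..k}.
        prob_space.conditional_mutual_information (sample_space k \<pi> \<mu>) 2
          (\<Pi>\<^sub>M j\<in>{1..k} - {i}. count_space UNIV)
          (transcript_space k i)
          (count_space UNIV \<Otimes>\<^sub>M (priv \<pi> i \<Otimes>\<^sub>M pub \<pi>))
          (\<lambda>(x, r, p). restrict x ({1..k} - {i}))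
          (transcript k \<pi> i)
          (\<lambda>(x, r, p). (x i, r i, p))
      + prob_space.conditional_mutual_information (sample_space k \<pi> \<mu>) 2
          (count_space UNIV)
          (transcript_space k i)
          ((\<Pi>\<^sub>M j\<in>{1..k} - {i}. count_space UNIV) \<Otimes>\<^sub>M ((\<Pi>\<^sub>M j\<in>{1..k} - {i}. priv \<pi> j) \<Otimes>\<^sub>M pub \<pi>))
          (\<lambda>(x, r, p). x i)
          (transcript k \<pi> i)
          (\<lambda>(x, r, p). (restrict x ({1..k} - {i}), restrict r ({1..k} - {i}), p)))"

definition uniform_inputs :: "nat \<Rightarrow> (nat \<Rightarrow> bool) pmf" where
  "uniform_inputs k = pmf_of_set (inputs k)"

end

theory Submission
  imports Defs "HOL-Library.Sublist"
begin

text \<open>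
  Only the terms \<open>I(X\<^sub>i; \<Pi>\<^sub>i | X\<^sub>-\<^sub>i R\<^sub>-\<^sub>i R\<^sup>p)\<close> with \<open>i \<noteq> 1\<close> are needed; all others are nonnegative.  The players other
  than \<open>i\<close> depend on player \<open>i\<close> only through the messages sent by \<open>i\<close>.  By confluence, a run in which
  these messages, taken from \<open>\<Pi>\<^sub>i\<close>, are all put on the links at the start ends in the same states of
  the other players.  Hence \<open>\<Pi>\<^sub>i\<close> and \<open>X\<^sub>-\<^sub>i, R\<^sub>-\<^sub>i, R\<^sup>p\<close> determine the output of player \<open>1\<close>, and with it a
  guess of the uniform bit \<open>X\<^sub>i\<close> that is correct with probability at least \<open>1 - \<epsilon>\<close>.  Since \<open>X\<^sub>i\<close> is
  independent of the condition, the term is at least a constant depending on \<open>\<epsilon>\<close> only.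
\<close>

section \<open>Mutual information with a guessable bit\<close>

text \<open>Without a density, or with a divergent integral, the divergence is the junk value \<open>0\<close>.\<close>

lemma KL_divergence_nonneg:
  assumes "1 < b" "prob_space M" "prob_space N"
  shows "0 \<le> KL_divergence b M N"
proof -
  interpret M: prob_space M by fact
  interpret N: prob_space N by fact
  interpret I: information_space M b by unfold_locales fact
  show ?thesis
  proof (cases "\<exists>f. f \<in> borel_measurable M \<and> density M f = N")
    case False
    then have "RN_deriv M N = (\<lambda>_. 0)" by (auto simp: RN_deriv_def)
    then show ?thesis
      by (simp add: KL_divergence_def entropy_density_def comp_def log_def)
  next
    case True
    then obtain f where f: "f \<in> borel_measurable M" "density M f = N" by blast
    have "absolutely_continuous M N" "sets N = sets M"
      using f absolutely_continuousI_density by auto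
    from M.real_RN_deriv[OF N.finite_measure_axioms this] obtain D :: "_ \<Rightarrow> real"
      where D: "D \<in> borel_measurable M" "AE x in M. RN_deriv M N x = ennreal (D x)" "\<And>x. 0 \<le> D x"
      by metis
    have "N = density M (RN_deriv M N)"
      using f by (metis RN_derivI)
    also have "\<dots> = density M D"
      using D by (auto intro!: density_cong)
    finally have N: "N = density M D" .
    show ?thesis
    proof (cases "integrable M (\<lambda>x. D x * log b (D x))")
      case True
      then show ?thesis
        unfolding N using D assms(3) by (intro I.KL_nonneg) (auto simp: N)
    next
      case False
      have "KL_divergence b M N = (\<integral>x. D x * log b (D x) \<partial>M)"
        unfolding N using D assms by (intro M.KL_density) auto
      then show ?thesis using False by (simp add: not_integrable_integral_eq)
    qed
  qed
qed

text \<open>Makes \<open>D * log b D\<close> integrable for a bounded density \<open>D\<close>.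
  Below 1, \<open>ln (1/d) <= 1/d - 1\<close> gives the bound 1; above 1,
  \<open>ln d <= d - 1\<close> gives the bound \<open>c * c\<close>.\<close>

lemma abs_mult_ln_le:
  fixes d :: real
  assumes "0 \<le> d" "d \<le> c"
  shows "\<bar>d * ln d\<bar> \<le> 1 + c\<^sup>2"
proof -
  consider "d = 0" | "0 < d" "d < 1" | "1 \<le> d" using assms by linarith
  then show ?thesis
  proof cases
    case 2
    have "- ln d \<le> 1 / d - 1"
      using ln_le_minus_one[of "1 / d"] 2 by (simp add: ln_div)
    then have "d * (- ln d) \<le> d * (1 / d - 1)" using 2 by (intro mult_left_mono) auto
    also have "\<dots> \<le> 1" using 2 by (simp add: field_simps)
    finally have "\<bar>d * ln d\<bar> \<le> 1"
      using 2 by (simp add: abs_mult abs_of_neg)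
    then show ?thesis by (smt (verit) zero_le_power2)
  next
    case 3
    have "d * ln d \<le> c * c"
      using 3 assms ln_le_minus_one[of d] by (intro mult_mono) auto
    then show ?thesis using 3 by (simp add: power2_eq_square)
  qed simp
qed

text \<open>
  The easy half of the Donsker-Varadhan principle.  The domination of \<^term>\<open>N\<close> by \<^term>\<open>M\<close> makes
  the divergence finite, which excludes the junk value.
\<close>

lemma KL_divergence_ge_integral_log:
  fixes q :: "'a \<Rightarrow> real"
  assumes "1 < b" "prob_space M" "prob_space N" and sets: "sets N = sets M"
    and dom: "\<And>A. A \<in> sets M \<Longrightarrow> emeasure N A \<le> ennreal C * emeasure M A"
    and [measurable]: "q \<in> borel_measurable M"
    and q: "\<And>x. x \<in> space M \<Longrightarrow> l \<le> q x" "\<And>x. x \<in> space M \<Longrightarrow> q x \<le> u" "0 < l"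
    and q1: "(\<integral>x. q x \<partial>M) \<le> 1"
  shows "(\<integral>x. log b (q x) \<partial>N) \<le> KL_divergence b M N"
proof -
  interpret M: prob_space M by fact
  interpret N: prob_space N by fact
  \<comment> \<open>A negative \<open>C\<close> would be truncated to 0 by \<open>ennreal\<close>,
    and domination would then give \<open>N\<close> total mass 0.\<close>
  have C: "0 \<le> C"
  proof (rule ccontr)
    assume "\<not> 0 \<le> C"
    then show False using dom[of "space M"] N.emeasure_space_1 sets_eq_imp_space_eq[OF sets]
      by (simp add: ennreal_neg)
  qed
  have ac: "absolutely_continuous M N"
    unfolding absolutely_continuous_def
  proof
    fix A assume "A \<in> null_sets M"
    then show "A \<in> null_sets N" using dom[of A] sets by (auto simp: null_sets_def)
  qed
  from M.real_RN_deriv[OF N.finite_measure_axioms ac sets] obtain D :: "'a \<Rightarrow> real"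
    where D: "D \<in> borel_measurable M" "AE x in M. RN_deriv M N x = ennreal (D x)" "\<And>x. 0 \<le> D x"
    by metis
  note [measurable] = D(1)
  have "N = density M (RN_deriv M N)"
    using M.density_RN_deriv[OF ac sets] by simp
  also have "\<dots> = density M D"
    using D by (auto intro!: density_cong)
  finally have N: "N = density M D" .
  \<comment> \<open>The bound on measures passes to the density: on \<open>A\<close>, where
    \<open>D\<close> exceeds \<open>C\<close>, the nonnegative function \<open>D - C\<close> has
    integral \<open>N A - C * M A\<close>. Domination makes this truncated difference 0, so
    \<open>A\<close> is null.\<close>
  have D_le: "AE x in M. D x \<le> C"
  proof -
    define A where "A = {x \<in> space M. C < D x}"
    have [measurable]: "A \<in> sets M" unfolding A_def by measurable
    have "(\<integral>\<^sup>+x. ennreal ((D x - C) * indicator A x) \<partial>M)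
        = (\<integral>\<^sup>+x. ennreal (D x) * indicator A x - ennreal C * indicator A x \<partial>M)"
      using C by (intro nn_integral_cong) (auto simp: indicator_def ennreal_minus)
    also have "\<dots> = (\<integral>\<^sup>+x. ennreal (D x) * indicator A x \<partial>M) - (\<integral>\<^sup>+x. ennreal C * indicator A x \<partial>M)"
    proof (rule nn_integral_diff)
      show "(\<integral>\<^sup>+x. ennreal C * indicator A x \<partial>M) \<noteq> \<infinity>"
        by (simp add: nn_integral_cmult_indicator ennreal_mult_eq_top_iff)
      show "AE x in M. ennreal C * indicator A x \<le> ennreal (D x) * indicator A x"
        by (auto simp: A_def indicator_def intro!: ennreal_leI)
    qed measurable
    also have "\<dots> = emeasure N A - ennreal C * emeasure M A"
      by (simp add: N emeasure_density nn_integral_cmult_indicator)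
    also have "\<dots> = 0"
      using dom[of A] by (simp add: diff_eq_0_iff_ennreal N.emeasure_eq_measure)
    finally have "AE x in M. ennreal ((D x - C) * indicator A x) = 0"
      by (subst (asm) nn_integral_0_iff_AE) auto
    then show ?thesis
      by (rule AE_mp) (auto simp: A_def indicator_def ennreal_eq_0_iff)
  qed
  have int: "integrable M (\<lambda>x. D x * log b (D x))"
  proof (rule M.integrable_const_bound[where B = "(1 + C\<^sup>2) / ln b"])
    show "AE x in M. norm (D x * log b (D x)) \<le> (1 + C\<^sup>2) / ln b"
      using D_le
    proof eventually_elim
      case (elim x)
      then show ?case
        using abs_mult_ln_le[of "D x" C] D(3)[of x] assms(1)
        by (simp add: log_def divide_right_mono)
    qed
  qed measurable
  have q_int: "integrable M q"
    using q by (intro M.integrable_const_bound[where B = u]) (auto intro!: AE_I2 simp: abs_le_iff, force)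
  have D_int: "integrable M D"
    using D_le D(3) by (intro M.integrable_const_bound[where B = C]) auto
  have "1 = emeasure N (space M)"
    using N.emeasure_space_1 sets_eq_imp_space_eq[OF sets] by simp
  also have "\<dots> = (\<integral>\<^sup>+x. ennreal (D x) \<partial>M)"
    by (simp add: N emeasure_density cong: nn_integral_cong)
  also have "\<dots> = ennreal (\<integral>x. D x \<partial>M)"
    using D_int D(3) by (intro nn_integral_eq_integral) auto
  finally have D1: "(\<integral>x. D x \<partial>M) = 1"
    by (metis ennreal_eq_1)
  have Dq_int: "integrable M (\<lambda>x. D x * log b (q x))"
  proof (rule Bochner_Integration.integrable_bound)
    show "integrable M (\<lambda>x. D x * (\<bar>log b l\<bar> + \<bar>log b u\<bar>))" using D_int by simp
    show "AE x in M. norm (D x * log b (q x)) \<le> norm (D x * (\<bar>log b l\<bar> + \<bar>log b u\<bar>))"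
    proof (rule AE_I2)
      fix x assume "x \<in> space M"
      then have "log b l \<le> log b (q x)" "log b (q x) \<le> log b u"
        using q(1,2)[of x] q(3) assms(1) by (auto intro!: log_mono)
      then have "\<bar>log b (q x)\<bar> \<le> \<bar>log b l\<bar> + \<bar>log b u\<bar>" by linarith
      then show "norm (D x * log b (q x)) \<le> norm (D x * (\<bar>log b l\<bar> + \<bar>log b u\<bar>))"
        using D(3)[of x] by (simp add: abs_mult mult_left_mono)
    qed
  qed measurable
  \<comment> \<open>Gibbs' inequality: \<open>ln z <= z - 1\<close> at \<open>z = q/D\<close> gives
    \<open>D - q <= D ln D - D ln q\<close> pointwise. After integration the left side is
    nonnegative, since \<open>D\<close> has integral 1 and \<open>q\<close> at most 1.\<close>
  have "0 \<le> (1 - (\<integral>x. q x \<partial>M)) / ln b"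
    using q1 assms(1) by simp
  also have "\<dots> = (\<integral>x. (D x - q x) / ln b \<partial>M)"
    using D_int q_int D1 by simp
  also have "\<dots> \<le> (\<integral>x. D x * log b (D x) - D x * log b (q x) \<partial>M)"
  proof (rule integral_mono)
    fix x assume x: "x \<in> space M"
    have "D x - q x \<le> D x * ln (D x) - D x * ln (q x)"
    proof (cases "D x = 0")
      case False
      then have pos: "0 < D x" "0 < q x" using D(3)[of x] q(1)[OF x] q(3) by auto
      have "ln (q x / D x) \<le> q x / D x - 1" using pos by (intro ln_le_minus_one) auto
      then have "D x * ln (q x / D x) \<le> D x * (q x / D x - 1)"
        using pos by (intro mult_left_mono) auto
      also have "\<dots> = q x - D x" using pos by (simp add: field_simps)
      finally show ?thesis using pos by (simp add: ln_div right_diff_distrib)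
    qed (use q(1)[OF x] q(3) in auto)
    then have "(D x - q x) / ln b \<le> (D x * ln (D x) - D x * ln (q x)) / ln b"
      using assms(1) by (intro divide_right_mono) auto
    then show "(D x - q x) / ln b \<le> D x * log b (D x) - D x * log b (q x)"
      by (simp add: log_def diff_divide_distrib)
  qed (use D_int q_int int Dq_int in auto)
  also have "\<dots> = (\<integral>x. D x * log b (D x) \<partial>M) - (\<integral>x. D x * log b (q x) \<partial>M)"
    using int Dq_int by simp
  also have "(\<integral>x. D x * log b (D x) \<partial>M) = KL_divergence b M N"
    unfolding N using D assms by (intro M.KL_density[symmetric]) auto
  also have "(\<integral>x. D x * log b (q x) \<partial>M) = (\<integral>x. log b (q x) \<partial>N)"
    unfolding N using D(3) by (subst integral_real_density) auto
  finally show ?thesis by simp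
qed

lemma (in prob_space) mutual_information_nonneg:
  assumes "1 < b" "X \<in> M \<rightarrow>\<^sub>M S" "Y \<in> M \<rightarrow>\<^sub>M T"
  shows "0 \<le> mutual_information b S T X Y"
  unfolding mutual_information_def using assms
  by (intro KL_divergence_nonneg prob_space_pair prob_space_distr) auto

text \<open>
  A test function that bets on the guess \<open>h \<circ> W\<close> with stake proportional to the advantage \<open>1 - 2 \<epsilon>\<close>
  replaces Fano's inequality.
\<close>

lemma (in prob_space) mutual_information_bit_ge:
  fixes X :: "'a \<Rightarrow> bool" and h :: "'b \<Rightarrow> bool"
  assumes X: "distr M (count_space UNIV) X = measure_pmf (bernoulli_pmf (1 / 2))"
    and [measurable]: "X \<in> M \<rightarrow>\<^sub>M count_space UNIV" "W \<in> M \<rightarrow>\<^sub>M T" "h \<in> T \<rightarrow>\<^sub>M count_space UNIV"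
    and \<epsilon>: "0 \<le> \<epsilon>" "\<epsilon> \<le> 1 / 2"
    and correct: "1 - \<epsilon> \<le> prob {\<omega> \<in> space M. h (W \<omega>) = X \<omega>}"
  shows "(1 - 2 * \<epsilon>)\<^sup>2 / 8 \<le> mutual_information 2 (count_space UNIV) T X W"
proof -
  \<comment> \<open>With \<open>ln (1 + u) >= u - 2 u^2\<close>, a guess that is correct with
    probability \<open>1 - \<epsilon>\<close> has expected logarithm at least
    \<open>t (1 - 2 \<epsilon>) - 2 t^2\<close>. This stake maximizes that bound, with value
    \<open>(1 - 2 \<epsilon>)^2 / 8\<close>.\<close>
  define t where "t = (1 - 2 * \<epsilon>) / 4"
  have t: "0 \<le> t" "t \<le> 1 / 4" using \<epsilon> by (auto simp: t_def)
  define q where "q = (\<lambda>(a, w). if h w = a then 1 + t else 1 - t)"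
  let ?PX = "distr M (count_space UNIV) X" and ?PW = "distr M T W"
  let ?N = "distr M (count_space UNIV \<Otimes>\<^sub>M T) (\<lambda>x. (X x, W x))"
  interpret PX: prob_space ?PX by (rule prob_space_distr) simp
  interpret PW: prob_space ?PW by (rule prob_space_distr) simp
  interpret P: pair_prob_space ?PX ?PW ..
  have sets: "sets (?PX \<Otimes>\<^sub>M ?PW) = sets (count_space UNIV \<Otimes>\<^sub>M T)"
    by (intro sets_pair_measure_cong) auto
  have [measurable]: "q \<in> borel_measurable (count_space UNIV \<Otimes>\<^sub>M T)"
    unfolding q_def by measurable
  have "(\<integral>x. log 2 (q x) \<partial>?N) \<le> KL_divergence 2 (?PX \<Otimes>\<^sub>M ?PW) ?N"
  proof (rule KL_divergence_ge_integral_log[where C = 2 and l = "1 - t" and u = "1 + t"])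
    show "prob_space (?PX \<Otimes>\<^sub>M ?PW)" by (rule P.prob_space_axioms)
    show "prob_space ?N" by (rule prob_space_distr) simp
    show "sets ?N = sets (?PX \<Otimes>\<^sub>M ?PW)" by (simp add: sets)
    show "q \<in> borel_measurable (?PX \<Otimes>\<^sub>M ?PW)" by measurable
    show "1 - t \<le> q x" "q x \<le> 1 + t" for x using t by (auto simp: q_def split: prod.splits)
    fix A assume "A \<in> sets (?PX \<Otimes>\<^sub>M ?PW)"
    then have A: "A \<in> sets (count_space UNIV \<Otimes>\<^sub>M T)" by (simp add: sets)
    define B where "B = (\<lambda>a. Pair a -` A)"
    have [measurable]: "B a \<in> sets T" for a
      unfolding B_def using A by (rule sets_Pair1)
    \<comment> \<open>Source of the factor 2: whatever the bit is, \<open>W\<close> lies in one of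
      the two sections of \<open>A\<close>, while the product measure weights each section by
      1/2.\<close>
    have "emeasure ?N A = emeasure M ((\<lambda>x. (X x, W x)) -` A \<inter> space M)"
      using A by (simp add: emeasure_distr)
    also have "\<dots> \<le> emeasure M ((W -` B True \<inter> space M) \<union> (W -` B False \<inter> space M))"
    proof (rule emeasure_mono)
      show "(\<lambda>x. (X x, W x)) -` A \<inter> space M \<subseteq> (W -` B True \<inter> space M) \<union> (W -` B False \<inter> space M)"
        by (auto simp: B_def) (metis (full_types))
    qed measurable
    also have "\<dots> \<le> emeasure ?PW (B True) + emeasure ?PW (B False)"
      by (simp add: emeasure_distr) (intro emeasure_subadditive, measurable)
    also have "\<dots> = 2 * (\<integral>\<^sup>+a. emeasure ?PW (B a) \<partial>?PX)"
    proof -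
      have "ennreal 2 * ennreal (1 / 2) = 1"
        by (subst ennreal_mult[symmetric]) auto
      moreover have "2 * (c * ennreal (1 / 2)) = c * (ennreal 2 * ennreal (1 / 2))" for c :: ennreal
        unfolding ennreal_numeral by (rule mult.left_commute)
      ultimately have half: "2 * (c * ennreal (1 / 2)) = c" for c :: ennreal
        by (metis mult.right_neutral)
      show ?thesis unfolding X by (simp add: distrib_left half del: ennreal_half)
    qed
    also have "\<dots> = 2 * emeasure (?PX \<Otimes>\<^sub>M ?PW) A"
      using A by (subst PW.emeasure_pair_measure_alt) (auto simp: B_def sets)
    finally show "emeasure ?N A \<le> ennreal 2 * emeasure (?PX \<Otimes>\<^sub>M ?PW) A" by simp
  next
    have int: "integrable (?PX \<Otimes>\<^sub>M ?PW) q"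
      using t by (intro P.integrable_const_bound[where B = 2]) (auto intro!: AE_I2 simp: q_def)
    have "integrable ?PW (\<lambda>w. q (a, w))" for a
      using t by (intro PW.integrable_const_bound[where B = 2]) (auto intro!: AE_I2 simp: q_def)
    \<comment> \<open>For a fixed \<open>w\<close> exactly one value of the bit agrees with
      \<open>h w\<close>, so the two values of \<open>q\<close> are \<open>1 + t\<close> and
      \<open>1 - t\<close>, with average 1.\<close>
    then have "(\<integral>a. (\<integral>w. q (a, w) \<partial>?PW) \<partial>?PX) = (\<integral>w. (q (True, w) + q (False, w)) / 2 \<partial>?PW)"
      unfolding X by (simp add: field_simps)
    also have "\<dots> = (\<integral>w. 1 \<partial>?PW)"
      by (intro Bochner_Integration.integral_cong) (auto simp: q_def)
    also have "\<dots> = 1" using PW.prob_space by simp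
    finally show "(\<integral>x. q x \<partial>(?PX \<Otimes>\<^sub>M ?PW)) \<le> 1"
      using P.integral_fst'[OF int] by simp
  qed (use t in auto)
  moreover have "(1 - 2 * \<epsilon>)\<^sup>2 / 8 \<le> (\<integral>x. log 2 (q x) \<partial>?N)"
  proof -
    let ?c = "indicator {\<omega> \<in> space M. h (W \<omega>) = X \<omega>} :: 'a \<Rightarrow> real"
    have [measurable]: "{\<omega> \<in> space M. h (W \<omega>) = X \<omega>} \<in> events" by measurable
    have int: "integrable M ?c" by (rule integrable_real_indicator) (simp_all add: emeasure_eq_measure)
    have lt: "(u - 2 * u\<^sup>2) / ln 2 \<le> log 2 (1 + u)" if "\<bar>u\<bar> \<le> 1 / 4" for u :: real
      using abs_ln_one_plus_x_minus_x_bound[of u] that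
      by (auto simp: log_def intro!: divide_right_mono)
    have E: "(1 - 2 * \<epsilon>)\<^sup>2 / 8 = 2 * t * (1 - \<epsilon>) - (t + 2 * t\<^sup>2)"
      by (simp add: t_def power2_eq_square field_simps)
    \<comment> \<open>Passing from natural to binary logarithms only helps, because
      \<open>ln 2 < 1\<close>.\<close>
    have "(1 - 2 * \<epsilon>)\<^sup>2 / 8 \<le> (1 - 2 * \<epsilon>)\<^sup>2 / 8 / ln 2"
      using ln_2_less_1 by (simp add: le_divide_eq mult_left_le)
    also have "\<dots> \<le> (2 * t * prob {\<omega> \<in> space M. h (W \<omega>) = X \<omega>} - (t + 2 * t\<^sup>2)) / ln 2"
      unfolding E using t correct by (intro divide_right_mono diff_right_mono mult_left_mono) auto
    also have "\<dots> = (\<integral>\<omega>. (2 * t * ?c \<omega> - (t + 2 * t\<^sup>2)) / ln 2 \<partial>M)"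
      using prob_space int by simp
    also have "\<dots> \<le> (\<integral>\<omega>. log 2 (q (X \<omega>, W \<omega>)) \<partial>M)"
    proof (rule integral_mono)
      show "integrable M (\<lambda>\<omega>. log 2 (q (X \<omega>, W \<omega>)))"
        using t
        by (intro integrable_const_bound[where B = "\<bar>log 2 (1 + t)\<bar> + \<bar>log 2 (1 - t)\<bar>"])
           (auto intro!: AE_I2 simp: q_def)
      fix \<omega> assume "\<omega> \<in> space M"
      then show "(2 * t * ?c \<omega> - (t + 2 * t\<^sup>2)) / ln 2 \<le> log 2 (q (X \<omega>, W \<omega>))"
        using lt[of t] lt[of "- t"] t by (auto simp: q_def indicator_def)
    qed (use int in simp)
    also have "\<dots> = (\<integral>x. log 2 (q x) \<partial>?N)"
      by (subst integral_distr) auto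
    finally show ?thesis .
  qed
  ultimately show ?thesis unfolding mutual_information_def by linarith
qed

text \<open>The subtracted term of each conditional mutual information has this form.
  \<open>A\<close> and \<open>B\<close> are independent under \<open>\<mu>\<close>, and
  \<open>C\<close> depends on the independent factor \<open>N\<close> only, so the joint law is the
  product law, and the divergence of a measure from itself is 0.\<close>

lemma mutual_information_independent:
  assumes "prob_space N" and [measurable]: "C \<in> N \<rightarrow>\<^sub>M T2"
    and AS: "A \<in> UNIV \<rightarrow> space S" and BT: "B \<in> UNIV \<rightarrow> space T1"
    and pair: "map_pmf (\<lambda>x. (A x, B x)) \<mu> = pair_pmf (map_pmf A \<mu>) (map_pmf B \<mu>)"
  shows "prob_space.mutual_information (measure_pmf \<mu> \<Otimes>\<^sub>M N) b S (T1 \<Otimes>\<^sub>M T2)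
           (\<lambda>(x, \<omega>). A x) (\<lambda>(x, \<omega>). (B x, C \<omega>)) = 0"
proof -
  let ?M = "measure_pmf \<mu> \<Otimes>\<^sub>M N"
  let ?X = "\<lambda>(x, \<omega>). A x" and ?Z = "\<lambda>(x, \<omega>). (B x, C \<omega>)"
  interpret N: prob_space N by fact
  interpret \<mu>: prob_space "measure_pmf \<mu>" by (rule prob_space_measure_pmf)
  interpret M: pair_prob_space "measure_pmf \<mu>" N ..
  have [measurable]: "A \<in> measure_pmf \<mu> \<rightarrow>\<^sub>M S" "B \<in> measure_pmf \<mu> \<rightarrow>\<^sub>M T1"
    using AS BT by (auto simp: measurable_def)
  interpret PX: prob_space "distr ?M S ?X" by (rule M.prob_space_distr) simp
  interpret PZ: prob_space "distr ?M (T1 \<Otimes>\<^sub>M T2) ?Z" by (rule M.prob_space_distr) simp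
  have "distr ?M S ?X \<Otimes>\<^sub>M distr ?M (T1 \<Otimes>\<^sub>M T2) ?Z = distr ?M (S \<Otimes>\<^sub>M (T1 \<Otimes>\<^sub>M T2)) (\<lambda>x. (?X x, ?Z x))"
  proof (rule pair_measure_eqI)
    fix E F assume "E \<in> sets (distr ?M S ?X)" "F \<in> sets (distr ?M (T1 \<Otimes>\<^sub>M T2) ?Z)"
    then have [measurable]: "E \<in> sets S" "F \<in> sets (T1 \<Otimes>\<^sub>M T2)" by auto
    have emeas: "emeasure ?M D = (\<integral>\<^sup>+x. emeasure N (Pair x -` D) \<partial>measure_pmf \<mu>)"
      if "D \<in> sets ?M" for D
      using that by (rule N.emeasure_pair_measure_alt)
    \<comment> \<open>Integrating out \<open>N\<close> first turns the measure of every rectangle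
      into an integral over \<open>\<mu>\<close>; there \<open>pair\<close> factors the integrand
      \<open>indicator E (A x) * g (B x)\<close>.\<close>
    define g where "g c = emeasure N {\<omega> \<in> space N. (c, C \<omega>) \<in> F}" for c
    have E: "emeasure (distr ?M S ?X) E = (\<integral>\<^sup>+x. indicator E (A x) \<partial>measure_pmf \<mu>)"
    proof -
      have "Pair x -` (?X -` E \<inter> space ?M) = (if A x \<in> E then space N else {})" for x
        by (auto simp: space_pair_measure)
      then show ?thesis
        by (subst emeasure_distr, simp, simp, subst emeas)
           (auto simp: N.emeasure_space_1 indicator_def intro!: nn_integral_cong)
    qed
    have F: "emeasure (distr ?M (T1 \<Otimes>\<^sub>M T2) ?Z) F = (\<integral>\<^sup>+x. g (B x) \<partial>measure_pmf \<mu>)"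
    proof -
      have "Pair x -` (?Z -` F \<inter> space ?M) = {\<omega> \<in> space N. (B x, C \<omega>) \<in> F}" for x
        by (auto simp: space_pair_measure)
      then show ?thesis
        by (subst emeasure_distr, simp, simp, subst emeas) (auto simp: g_def)
    qed
    have EF: "emeasure (distr ?M (S \<Otimes>\<^sub>M (T1 \<Otimes>\<^sub>M T2)) (\<lambda>x. (?X x, ?Z x))) (E \<times> F)
        = (\<integral>\<^sup>+x. indicator E (A x) * g (B x) \<partial>measure_pmf \<mu>)"
    proof -
      have "Pair x -` ((\<lambda>x. (?X x, ?Z x)) -` (E \<times> F) \<inter> space ?M)
          = (if A x \<in> E then {\<omega> \<in> space N. (B x, C \<omega>) \<in> F} else {})" for x
        by (auto simp: space_pair_measure)
      then show ?thesis
        by (subst emeasure_distr, simp, simp, subst emeas)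
           (auto simp: g_def indicator_def intro!: nn_integral_cong)
    qed
    have "(\<integral>\<^sup>+x. indicator E (A x) * g (B x) \<partial>measure_pmf \<mu>)
        = (\<integral>\<^sup>+(a, c). indicator E a * g c \<partial>measure_pmf (map_pmf (\<lambda>x. (A x, B x)) \<mu>))"
      by simp
    also have "\<dots> = (\<integral>\<^sup>+x. indicator E (A x) \<partial>measure_pmf \<mu>) * (\<integral>\<^sup>+x. g (B x) \<partial>measure_pmf \<mu>)"
      unfolding pair by (simp add: nn_integral_pair_pmf' nn_integral_cmult nn_integral_multc)
    finally show "emeasure (distr ?M S ?X) E * emeasure (distr ?M (T1 \<Otimes>\<^sub>M T2) ?Z) F =
        emeasure (distr ?M (S \<Otimes>\<^sub>M (T1 \<Otimes>\<^sub>M T2)) (\<lambda>x. (?X x, ?Z x))) (E \<times> F)"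
      using E F EF by simp
  qed (auto intro: PX.sigma_finite_measure_axioms PZ.sigma_finite_measure_axioms cong: sets_pair_measure_cong)
  then show ?thesis
    unfolding M.mutual_information_def
    by (simp add: sigma_finite_measure.KL_same_eq_0 prob_space_imp_sigma_finite M.prob_space_distr)
qed

section \<open>Scheduled runs\<close>

definition sched_step ::
  "protocol \<Rightarrow> nat set \<Rightarrow> (nat \<Rightarrow> bool) \<Rightarrow> (nat \<Rightarrow> rstr) \<Rightarrow> rstr \<Rightarrow> nat \<Rightarrow> conf \<Rightarrow> conf" where
  "sched_step \<pi> J x r p i c =
     (if i \<in> J \<and> enabled c i then c(i := advance \<pi> x r p c i) else c)"

text \<open>A fixed schedule makes the run a function of inputs and random strings. With
  \<open>J = {1..k}\<close> and start \<open>init_conf\<close> it is a genuine fair execution; with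
  one player left out of \<open>J\<close> and that player's messages already in the start
  configuration it is the simulation.\<close>

primrec round_robin ::
  "nat \<Rightarrow> protocol \<Rightarrow> nat set \<Rightarrow> (nat \<Rightarrow> bool) \<Rightarrow> (nat \<Rightarrow> rstr) \<Rightarrow> rstr \<Rightarrow> conf \<Rightarrow> nat \<Rightarrow> conf" where
  "round_robin k \<pi> J x r p c 0 = c"
| "round_robin k \<pi> J x r p c (Suc n) =
     sched_step \<pi> J x r p (Suc (n mod k)) (round_robin k \<pi> J x r p c n)"

text \<open>Fairness is phrased through changes of state, so every move must be visible: a move from
  \<open>Ready\<close> changes the status, and a read increases the round counter.\<close>

lemma advance_neq:
  assumes "enabled c i"
  shows "advance \<pi> x r p c i \<noteq> c i"
proof
  assume "advance \<pi> x r p c i = c i"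
  then have "status (advance \<pi> x r p c i) = status (c i)" "rnd (advance \<pi> x r p c i) = rnd (c i)"
    by auto
  then show False
    using assms by (auto simp: advance_def enabled_def Let_def split: status.splits option.splits)
qed

lemma execution_round_robin:
  assumes "J \<subseteq> {1..k}"
  shows "execution k \<pi> x r p (round_robin k \<pi> J x r p init_conf)"
  unfolding execution_def using assms by (auto simp: sched_step_def)

text \<open>A common frame for executions and simulations. Players in \<open>J\<close> obey the
  protocol, possibly several in one step; of the others only the monotonicity of their outgoing
  links is retained.\<close>

definition partial_run ::
  "protocol \<Rightarrow> nat set \<Rightarrow> (nat \<Rightarrow> bool) \<Rightarrow> (nat \<Rightarrow> rstr) \<Rightarrow> rstr \<Rightarrow> (nat \<Rightarrow> conf) \<Rightarrow> bool" where
  "partial_run \<pi> J x r p f \<longleftrightarrow>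
     (\<forall>n. \<forall>i\<in>J. f (Suc n) i = f n i \<or> enabled (f n) i \<and> f (Suc n) i = advance \<pi> x r p (f n) i) \<and>
     (\<forall>n i j. i \<notin> J \<longrightarrow> prefix (sent (f n i) j) (sent (f (Suc n) i) j))"

lemma prefix_sent_advance: "prefix (sent (c i) j) (sent (advance \<pi> x r p c i) j)"
  by (auto simp: advance_def Let_def split: status.splits)

lemma partial_run_execution:
  assumes "execution k \<pi> x r p f"
  shows "partial_run \<pi> J x r p f"
proof -
  have "f (Suc n) i = f n i \<or> enabled (f n) i \<and> f (Suc n) i = advance \<pi> x r p (f n) i" for n i
    using execution_move[OF assms, of n i] by blast
  then show ?thesis unfolding partial_run_def by (metis prefix_order.refl prefix_sent_advance)
qed

lemma partial_run_round_robin: "partial_run \<pi> J x r p (round_robin k \<pi> J x r p c)"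
  unfolding partial_run_def by (auto simp: sched_step_def)

lemma partial_run_prefix_sent:
  assumes "partial_run \<pi> J x r p f" "m \<le> n"
  shows "prefix (sent (f m i) j) (sent (f n i) j)"
  using assms(2)
proof (induction n rule: dec_induct)
  case (step n)
  have "prefix (sent (f n i) j) (sent (f (Suc n) i) j)"
    using assms(1) prefix_sent_advance[of "f n" i j \<pi> x r p] unfolding partial_run_def
    by (cases "i \<in> J") (metis prefix_order.refl)+
  with step.IH show ?case by (rule prefix_order.trans)
qed simp

section \<open>Fairness and confluence of partial runs\<close>

definition fair_on :: "nat set \<Rightarrow> (nat \<Rightarrow> conf) \<Rightarrow> bool" where
  "fair_on J f \<longleftrightarrow> (\<forall>i\<in>J. \<forall>n. enabled (f n) i \<longrightarrow> (\<exists>m\<ge>n. f (Suc m) i \<noteq> f m i))"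

lemma enabled_mono:
  assumes "enabled c i" "d i = c i" "\<And>j. prefix (sent (c j) i) (sent (d j) i)"
  shows "enabled d i"
  using assms(1,2) prefix_length_le[OF assms(3)]
  by (auto simp: enabled_def split: status.splits) (meson less_le_trans)

lemma partial_run_enabled:
  assumes f: "partial_run \<pi> J x r p f" and "enabled (f n) i" "n \<le> m" "f m i = f n i"
  shows "enabled (f m) i"
  using assms by (intro enabled_mono[of "f n" i "f m"] partial_run_prefix_sent[OF f]) auto

lemma fair_on_round_robin:
  assumes J: "J \<subseteq> {1..k}"
  shows "fair_on J (round_robin k \<pi> J x r p c)"
  unfolding fair_on_def
proof (intro ballI allI impI)
  fix i n
  let ?f = "round_robin k \<pi> J x r p c"
  assume i: "i \<in> J" and en: "enabled (?f n) i"
  show "\<exists>m\<ge>n. ?f (Suc m) i \<noteq> ?f m i"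
  proof (rule ccontr)
    assume *: "\<not> ?thesis"
    have const: "?f m i = ?f n i" if "n \<le> m" for m
      using that by (induction m rule: dec_induct) (use * in auto)
    have "0 < k" "i \<le> k" "1 \<le> i" using i J by force+
    \<comment> \<open>A time not before \<open>n\<close> at which the schedule selects
      \<open>i\<close>: step \<open>m\<close> serves player \<open>Suc (m mod k)\<close>. Until its
      first move \<open>i\<close> stays enabled, so it moves at this step at the latest.\<close>
    define m where "m = n * k + (i - 1)"
    have "m mod k = (i - 1) mod k" unfolding m_def by (rule mod_mult_self3)
    then have "Suc (m mod k) = i" using \<open>i \<le> k\<close> \<open>1 \<le> i\<close> by simp
    moreover have "n \<le> n * k" using \<open>0 < k\<close> by simp
    then have "n \<le> m" unfolding m_def by (rule trans_le_add1)
    ultimately have m: "n \<le> m" "Suc (m mod k) = i" by auto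
    have "enabled (?f m) i"
      by (rule partial_run_enabled[OF partial_run_round_robin en m(1) const[OF m(1)]])
    then have "?f (Suc m) i = advance \<pi> x r p (?f m) i"
      using m i by (simp add: sched_step_def)
    then show False
      using advance_neq[OF \<open>enabled (?f m) i\<close>, of \<pi> x r p] const[of m] const[of "Suc m"] m(1) by simp
  qed
qed

lemma partial_run_nth_sent:
  assumes "partial_run \<pi> J x r p f"
    and "a < length (sent (f m i) j)" "a < length (sent (f n i) j)"
  shows "sent (f m i) j ! a = sent (f n i) j ! a"
proof (cases "m \<le> n")
  case True
  then show ?thesis
    using partial_run_prefix_sent[OF assms(1) True, of i j] assms(2) by (auto simp: prefix_def nth_append)
next
  case False
  then show ?thesis
    using partial_run_prefix_sent[OF assms(1), of n m i j] assms(3) by (auto simp: prefix_def nth_append)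
qed

text \<open>Confluence. A player is deterministic and names the links it waits for, so the timing of
  arrivals cannot affect what it reads. The run \<open>f\<close> is fair and carries from the start
  everything that outsiders ever send into \<open>J\<close> in \<open>g\<close>; hence no player of
  \<open>J\<close> gets stuck in \<open>f\<close> before reaching its states in
  \<open>g\<close>.\<close>

lemma partial_run_local_states:
  assumes "finite J"
    and f: "partial_run \<pi> J x r p f" "fair_on J f"
    and g: "partial_run \<pi> J x r p g"
    and init: "\<And>i. i \<in> J \<Longrightarrow> f 0 i = g 0 i"
    and outside: "\<And>n i j. i \<notin> J \<Longrightarrow> j \<in> J \<Longrightarrow> prefix (sent (g n i) j) (sent (f 0 i) j)"
    and i: "i \<in> J"
  shows "\<exists>m. f m i = g n i"
  using i
proof (induction n arbitrary: i)
  case 0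
  then show ?case using init by blast
next
  case (Suc n)
  show ?case
  proof (cases "g (Suc n) i = g n i")
    case True
    then show ?thesis using Suc by auto
  next
    case False
    then have en: "enabled (g n) i" and adv: "g (Suc n) i = advance \<pi> x r p (g n) i"
      using g Suc.prems unfolding partial_run_def by auto
    obtain m where m: "f m i = g n i" using Suc by blast
    obtain T where T: "\<And>j. j \<in> J \<Longrightarrow> f (T j) j = g n j" using Suc.IH by metis
    \<comment> \<open>A time after \<open>m\<close> and after all \<open>T j\<close>: by then every
      link into \<open>i\<close> carries in \<open>f\<close> at least what it carries in
      \<open>g\<close> at time \<open>n\<close>. So if \<open>i\<close> has not moved since
      \<open>m\<close>, it is enabled.\<close>
    define Q where "Q = m + sum T J"
    have sent: "prefix (sent (g n j) i) (sent (f Q j) i)" for j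
    proof (cases "j \<in> J")
      case True
      then have "T j \<le> Q"
        using member_le_sum[of j J T] \<open>finite J\<close> by (auto simp: Q_def)
      then show ?thesis using partial_run_prefix_sent[OF f(1), of "T j" Q j i] T[OF True] by simp
    next
      case False
      then show ?thesis
        using outside[of j i n] partial_run_prefix_sent[OF f(1), of 0 Q j i] Suc.prems
        by (meson le0 prefix_order.trans)
    qed
    have "\<exists>q\<ge>m. f (Suc q) i \<noteq> f q i"
    proof (rule ccontr)
      assume *: "\<not> ?thesis"
      have const: "f q i = f m i" if "m \<le> q" for q
        using that by (induction q rule: dec_induct) (use * in auto)
      have "f Q i = g n i" using const[of Q] m by (simp add: Q_def)
      from enabled_mono[OF en this sent] have "enabled (f Q) i" .
      then obtain q where "Q \<le> q" "f (Suc q) i \<noteq> f q i"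
        using f(2) Suc.prems unfolding fair_on_def by blast
      then show False using * by (auto simp: Q_def)
    qed
    then obtain q0 where q0: "m \<le> q0 \<and> f (Suc q0) i \<noteq> f q0 i" by blast
    \<comment> \<open>The first move of \<open>i\<close> after \<open>m\<close>. Its state is still
      that of \<open>g n\<close> there, so both runs make this move from the same local
      state.\<close>
    define q where "q = (LEAST q. m \<le> q \<and> f (Suc q) i \<noteq> f q i)"
    have q: "m \<le> q" "f (Suc q) i \<noteq> f q i"
      unfolding q_def using LeastI[of "\<lambda>q. m \<le> q \<and> f (Suc q) i \<noteq> f q i", OF q0] by auto
    have qmin: "f (Suc t) i = f t i" if "m \<le> t" "t < q" for t
      using not_less_Least[of t "\<lambda>q. m \<le> q \<and> f (Suc q) i \<noteq> f q i"] that q_def by auto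
    have "f t i = f m i" if "m \<le> t" "t \<le> q" for t
      using that by (induction t rule: dec_induct) (auto simp: qmin)
    then have fq: "f q i = g n i" using q m by auto
    have mv: "enabled (f q) i" "f (Suc q) i = advance \<pi> x r p (f q) i"
      using f(1) q(2) Suc.prems unfolding partial_run_def by auto
    \<comment> \<open>The links may be filled to different lengths in \<open>f q\<close> and
      \<open>g n\<close>, but the contents agree at common positions, and only such positions are
      read.\<close>
    have "advance \<pi> x r p (f q) i = advance \<pi> x r p (g n) i"
    proof (rule advance_cong)
      fix j a
      assume a: "a < length (sent (f q j) i)" "a < length (sent (g n j) i)"
      have "sent (g n j) i ! a = sent (f Q j) i ! a" "a < length (sent (f Q j) i)"
        using a(2) sent[of j] by (auto simp: prefix_def nth_append)
      then show "sent (f q j) i ! a = sent (g n j) i ! a"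
        using partial_run_nth_sent[OF f(1) a(1)] by simp
    qed (use fq mv en in auto)
    then show ?thesis using mv adv by metis
  qed
qed

section \<open>Measurability of runs\<close>

text \<open>Configurations form an uncountable type, where measurability into the discrete
  sigma-algebra is hard to maintain under pairing and dependent composition. Countable range repairs
  this: one splits the space over the countably many values.\<close>

definition countably_measurable :: "'a measure \<Rightarrow> ('a \<Rightarrow> 'b) \<Rightarrow> bool" where
  "countably_measurable M f \<longleftrightarrow> f \<in> M \<rightarrow>\<^sub>M count_space UNIV \<and> countable (f ` space M)"

lemma countably_measurable_bind:
  assumes g: "countably_measurable M g" and f: "\<And>c. countably_measurable M (f c)"
  shows "countably_measurable M (\<lambda>\<omega>. f (g \<omega>) \<omega>)"
proof -
  have "g \<in> M \<rightarrow>\<^sub>M count_space (g ` space M)"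
  proof -
    have "g -` {c} \<inter> space M \<in> sets M" for c
      using g by (intro measurable_sets[of g M "count_space UNIV"]) (simp_all add: countably_measurable_def)
    moreover have "countable (g ` space M)"
      using g by (simp add: countably_measurable_def)
    ultimately show ?thesis
      by (simp add: measurable_count_space_eq_countable)
  qed
  then have "(\<lambda>\<omega>. f (g \<omega>) \<omega>) \<in> M \<rightarrow>\<^sub>M count_space UNIV"
    by (rule measurable_compose_countable'[where f = f, rotated])
       (use f g in \<open>simp_all add: countably_measurable_def\<close>)
  moreover have "(\<lambda>\<omega>. f (g \<omega>) \<omega>) ` space M \<subseteq> (\<Union>c\<in>g ` space M. f c ` space M)" by auto
  then have "countable ((\<lambda>\<omega>. f (g \<omega>) \<omega>) ` space M)"
  proof (rule countable_subset)
    have "countable (g ` space M)" "\<And>c. countable (f c ` space M)"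
      using f g by (simp_all add: countably_measurable_def)
    then show "countable (\<Union>c\<in>g ` space M. f c ` space M)" by (intro countable_UN)
  qed
  ultimately show ?thesis by (simp add: countably_measurable_def)
qed

lemma countably_measurable_const: "countably_measurable M (\<lambda>_. c)"
  by (simp add: countably_measurable_def image_constant_conv)

lemma countably_measurable_countable:
  fixes f :: "'a \<Rightarrow> 'b :: countable"
  shows "f \<in> M \<rightarrow>\<^sub>M count_space UNIV \<Longrightarrow> countably_measurable M f"
  by (simp add: countably_measurable_def)

lemma countably_measurable_map:
  "countably_measurable M g \<Longrightarrow> countably_measurable M (\<lambda>\<omega>. h (g \<omega>))"
  by (rule countably_measurable_bind[of M g "\<lambda>c _. h c"], assumption, rule countably_measurable_const)

lemma countably_measurable_compose:
  assumes g: "g \<in> N \<rightarrow>\<^sub>M M" and f: "countably_measurable M f"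
  shows "countably_measurable N (\<lambda>\<omega>. f (g \<omega>))"
proof -
  have "(\<lambda>\<omega>. f (g \<omega>)) \<in> N \<rightarrow>\<^sub>M count_space UNIV"
    by (rule measurable_compose[OF g]) (use f in \<open>simp add: countably_measurable_def\<close>)
  moreover have "(\<lambda>\<omega>. f (g \<omega>)) ` space N \<subseteq> f ` space M"
    using measurable_space[OF g] by blast
  ultimately show ?thesis
    using f countable_subset unfolding countably_measurable_def by blast
qed

lemma countably_measurable_cong:
  assumes "countably_measurable M f" "\<And>\<omega>. \<omega> \<in> space M \<Longrightarrow> f \<omega> = g \<omega>"
  shows "countably_measurable M g"
proof -
  have "f \<in> M \<rightarrow>\<^sub>M count_space UNIV \<longleftrightarrow> g \<in> M \<rightarrow>\<^sub>M count_space UNIV"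
    by (intro measurable_cong assms(2))
  moreover have "f ` space M = g ` space M"
    by (intro image_cong refl assms(2))
  ultimately show ?thesis using assms(1) by (simp add: countably_measurable_def)
qed

lemma countably_measurable_pair:
  assumes "countably_measurable M f" "countably_measurable M g"
  shows "countably_measurable M (\<lambda>\<omega>. (f \<omega>, g \<omega>))"
  by (rule countably_measurable_bind[of M f "\<lambda>a \<omega>. (a, g \<omega>)"])
     (intro assms countably_measurable_map[of M g])+

lemma countably_measurable_fun:
  assumes "finite J" "\<And>j. j \<in> J \<Longrightarrow> countably_measurable M (g j)"
  shows "countably_measurable M (\<lambda>\<omega> j. if j \<in> J then g j \<omega> else d j)"
  using assms
proof (induction J)
  case (insert a J)
  have "countably_measurable M (\<lambda>\<omega>. (g a \<omega>, \<lambda>j. if j \<in> J then g j \<omega> else d j))"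
    using insert by (intro countably_measurable_pair) auto
  from countably_measurable_map[OF this, of "\<lambda>(u, v). v(a := u)"]
  have "countably_measurable M (\<lambda>\<omega>. (\<lambda>j. if j \<in> J then g j \<omega> else d j)(a := g a \<omega>))"
    by (simp only: prod.case)
  also have "(\<lambda>\<omega>. (\<lambda>j. if j \<in> J then g j \<omega> else d j)(a := g a \<omega>)) =
      (\<lambda>\<omega> j. if j \<in> insert a J then g j \<omega> else d j)"
    by (auto simp: fun_eq_iff)
  finally show ?case .
qed (simp add: countably_measurable_const)

text \<open>Elements of the product are \<open>undefined\<close> outside the finite set
  \<open>I\<close>, so finitely many values from a countable type determine them. Input vectors and
  transcripts can thereby be treated as discrete data.\<close>

lemma countably_measurable_PiM:
  assumes "finite I"
  shows "countably_measurable (\<Pi>\<^sub>M i\<in>I. count_space (UNIV :: 'a :: countable set)) (\<lambda>y. y)"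
proof -
  let ?M = "\<Pi>\<^sub>M i\<in>I. count_space (UNIV :: 'a set)"
  have "countably_measurable ?M (\<lambda>y j. if j \<in> I then y j else undefined)"
    by (rule countably_measurable_fun[OF assms])
       (rule countably_measurable_countable, rule measurable_component_singleton)
  then show ?thesis
  proof (rule countably_measurable_cong)
    fix y assume "y \<in> space ?M"
    then have "y \<in> extensional I" by (simp add: space_PiM PiE_def)
    then show "(\<lambda>j. if j \<in> I then y j else undefined) = y"
      by (simp add: fun_eq_iff extensional_def)
  qed
qed

lemma countably_measurable_advance:
  assumes \<pi>: "is_protocol k \<pi>" and J: "J \<subseteq> {1..k}" and i: "i \<in> J"
  shows "countably_measurable ((\<Pi>\<^sub>M j\<in>J. priv \<pi> j) \<Otimes>\<^sub>M pub \<pi>) (\<lambda>(r, p). advance \<pi> x r p c i)"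
proof (cases "status (c i)")
  case Ready
  let ?M = "(\<Pi>\<^sub>M j\<in>J. priv \<pi> j) \<Otimes>\<^sub>M pub \<pi>"
  define l where "l = Suc (rnd (c i))"
  define v where "v = (\<lambda>(s, p). \<lparr>inp = x i, priv_str = s, pub_str = p, reads = rcvd (c i)\<rparr>)"
  define G where "G = (\<lambda>o' W s'. (c i)\<lparr>status := (case o' of Some w \<Rightarrow> Stopped w | None \<Rightarrow> Waiting W),
      sent := (\<lambda>j. sent (c i) j @ (case s' j of Some m \<Rightarrow> [m] | None \<Rightarrow> []))\<rparr>)"
  define \<rho> where "\<rho> = (\<lambda>(r :: nat \<Rightarrow> rstr, p :: rstr). (r i, p))"
  have [measurable]: "(\<lambda>r. r i) \<in> (\<Pi>\<^sub>M j\<in>J. priv \<pi> j) \<rightarrow>\<^sub>M priv \<pi> i"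
    using i by (rule measurable_component_singleton)
  have \<rho>: "\<rho> \<in> ?M \<rightarrow>\<^sub>M priv \<pi> i \<Otimes>\<^sub>M pub \<pi>"
    unfolding \<rho>_def by measurable
  have i': "i \<in> {1..k}" and l: "l \<ge> 1" using i J by (auto simp: l_def)
  have out: "(\<lambda>a. out \<pi> i l (v a)) \<in> priv \<pi> i \<Otimes>\<^sub>M pub \<pi> \<rightarrow>\<^sub>M count_space UNIV"
    and wait: "(\<lambda>a. wait \<pi> i l (v a)) \<in> priv \<pi> i \<Otimes>\<^sub>M pub \<pi> \<rightarrow>\<^sub>M count_space UNIV"
    and send: "(\<lambda>a. send \<pi> i l (v a) j) \<in> priv \<pi> i \<Otimes>\<^sub>M pub \<pi> \<rightarrow>\<^sub>M count_space UNIV" for j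
    using \<pi> i' l unfolding is_protocol_def v_def by (simp_all add: case_prod_unfold)
  have sub: "{j. send \<pi> i l w j \<noteq> None} \<subseteq> {1..k} - {i}" "wait \<pi> i l w \<subseteq> {1..k} - {i}" for w
    using \<pi> i' l unfolding is_protocol_def by blast+
  \<comment> \<open>The type of waiting sets is uncountable, but only subsets of
    \<open>{1..k}\<close> occur.\<close>
  have "countable ((\<lambda>a. wait \<pi> i l (v a)) ` space (priv \<pi> i \<Otimes>\<^sub>M pub \<pi>))"
    by (rule countable_finite, rule finite_subset[of _ "Pow {1..k}"]) (use sub(2) in \<open>blast, simp\<close>)
  with wait have wait': "countably_measurable ?M (\<lambda>\<omega>. wait \<pi> i l (v (\<rho> \<omega>)))"
    by (intro countably_measurable_compose[OF \<rho>]) (simp add: countably_measurable_def)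
  have out': "countably_measurable ?M (\<lambda>\<omega>. out \<pi> i l (v (\<rho> \<omega>)))"
    by (intro countably_measurable_compose[OF \<rho>] countably_measurable_countable out)
  \<comment> \<open>\<open>is_protocol\<close> gives measurability for each recipient separately.
    Since there are no recipients outside \<open>{1..k}\<close>, finitely many coordinates recover
    the whole sending function.\<close>
  have "countably_measurable ?M (\<lambda>\<omega> j. if j \<in> {1..k} then send \<pi> i l (v (\<rho> \<omega>)) j else None)"
    by (intro countably_measurable_fun countably_measurable_compose[OF \<rho>, of "\<lambda>a. send \<pi> i l (v a) _"]
        countably_measurable_countable send) auto
  also have "(\<lambda>\<omega> j. if j \<in> {1..k} then send \<pi> i l (v (\<rho> \<omega>)) j else None) =
      (\<lambda>\<omega>. send \<pi> i l (v (\<rho> \<omega>)))"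
  proof (intro ext)
    show "(if j \<in> {1..k} then send \<pi> i l (v (\<rho> \<omega>)) j else None) = send \<pi> i l (v (\<rho> \<omega>)) j" for \<omega> j
    proof (cases "j \<in> {1..k}")
      case False
      then have "send \<pi> i l (v (\<rho> \<omega>)) j = None" using sub(1) by blast
      then show ?thesis by simp
    qed simp
  qed
  finally have "countably_measurable ?M (\<lambda>\<omega>. (out \<pi> i l (v (\<rho> \<omega>)), wait \<pi> i l (v (\<rho> \<omega>)), send \<pi> i l (v (\<rho> \<omega>))))"
    using out' wait' by (intro countably_measurable_pair)
  from countably_measurable_map[OF this, of "\<lambda>(o', W, s'). G o' W s'"]
  have "countably_measurable ?M (\<lambda>\<omega>. G (out \<pi> i l (v (\<rho> \<omega>))) (wait \<pi> i l (v (\<rho> \<omega>))) (send \<pi> i l (v (\<rho> \<omega>))))"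
    by simp
  then show ?thesis
    using Ready by (simp add: advance_def Let_def v_def \<rho>_def l_def G_def case_prod_unfold)
qed (simp_all add: advance_def case_prod_unfold countably_measurable_const)

text \<open>Protocol functions are measurable in the random strings only for a fixed reading
  history, that is, for a fixed configuration. The previous configuration has countable range, so
  one may fix its value and bind.\<close>

lemma countably_measurable_round_robin:
  assumes \<pi>: "is_protocol k \<pi>" and J: "J \<subseteq> {1..k}"
  shows "countably_measurable ((\<Pi>\<^sub>M j\<in>J. priv \<pi> j) \<Otimes>\<^sub>M pub \<pi>) (\<lambda>(r, p). round_robin k \<pi> J x r p c n)"
proof (induction n)
  case 0
  then show ?case by (simp add: countably_measurable_const)
next
  case (Suc n)
  have "countably_measurable ((\<Pi>\<^sub>M j\<in>J. priv \<pi> j) \<Otimes>\<^sub>M pub \<pi>) (\<lambda>(r, p). sched_step \<pi> J x r p i d)" for i d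
  proof (cases "i \<in> J \<and> enabled d i")
    case True
    then show ?thesis
      using countably_measurable_map[OF countably_measurable_advance[OF \<pi> J, of i x d], of "\<lambda>s. d(i := s)"]
      by (simp add: sched_step_def case_prod_unfold)
  next
    case False
    then show ?thesis by (auto simp: sched_step_def countably_measurable_const case_prod_unfold)
  qed
  from countably_measurable_bind[OF Suc, of "\<lambda>d (r, p). sched_step \<pi> J x r p (Suc (n mod k)) d", OF this]
  show ?case by (simp add: case_prod_unfold)
qed

section \<open>The outcome as a measurable function of the random strings\<close>

lemma fair_on_imp_fair: "fair_on {1..k} f \<Longrightarrow> fair k f"
  by (auto simp: fair_on_def fair_def)

lemma ex_all_stopped:
  assumes "execution k \<pi> x r p f" "\<And>i. i \<in> {1..k} \<Longrightarrow> \<exists>n. stopped (f n i)"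
  shows "\<exists>n. \<forall>i\<in>{1..k}. stopped (f n i)"
proof -
  from assms(2) obtain T where T: "\<And>i. i \<in> {1..k} \<Longrightarrow> stopped (f (T i) i)" by metis
  have "stopped (f (sum T {1..k}) i)" if "i \<in> {1..k}" for i
    using execution_stopped[OF assms(1) T[OF that], of "sum T {1..k}"] T[OF that]
      member_le_sum[OF that, of T] by simp
  then show ?thesis by blast
qed

text \<open>Replaces the description operator in \<open>outcome\<close> by a concrete run: round
  robin over all players is a fair execution, hence it stops, and its final configuration is the
  unique one.\<close>

lemma outcome_eq_round_robin:
  assumes "always_stops k \<pi> x r p"
  defines "f \<equiv> round_robin k \<pi> {1..k} x r p init_conf"
  shows "\<exists>n. \<forall>i\<in>{1..k}. stopped (f n i)"
    and "\<forall>i\<in>{1..k}. stopped (f n i) \<Longrightarrow> outcome k \<pi> x r p = f n"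
proof -
  have ex: "execution k \<pi> x r p f" unfolding f_def by (rule execution_round_robin) simp
  moreover have "fair k f" unfolding f_def by (intro fair_on_imp_fair fair_on_round_robin) simp
  ultimately show "\<exists>n. \<forall>i\<in>{1..k}. stopped (f n i)"
    using assms(1) by (intro ex_all_stopped) (auto simp: always_stops_def)
  show "outcome k \<pi> x r p = f n" if "\<forall>i\<in>{1..k}. stopped (f n i)"
  proof -
    have "final_conf k \<pi> x r p (f n)" unfolding final_conf_def using that ex by blast
    then show ?thesis unfolding outcome_def by (blast intro: the_equality final_conf_unique)
  qed
qed

lemma countably_measurable_outcome:
  assumes \<pi>: "is_protocol k \<pi>"
    and stops: "\<And>r p. (r, p) \<in> space (randomness k \<pi>) \<Longrightarrow> always_stops k \<pi> x r p"
  shows "countably_measurable (randomness k \<pi>) (\<lambda>(r, p). outcome k \<pi> x r p)"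
proof -
  let ?F = "\<lambda>n (r, p). round_robin k \<pi> {1..k} x r p init_conf n"
  let ?stop = "\<lambda>c :: conf. \<forall>i\<in>{1..k}. stopped (c i)"
  \<comment> \<open>The stopping time depends on the random strings but is a natural number, so the
    run evaluated at \<open>T\<close> is again a countable bind.\<close>
  define T where "T = (\<lambda>\<omega>. LEAST n. ?stop (?F n \<omega>))"
  have F: "countably_measurable (randomness k \<pi>) (?F n)" for n
    unfolding randomness_def by (rule countably_measurable_round_robin[OF \<pi>]) simp
  have "(\<lambda>\<omega>. ?stop (?F n \<omega>)) \<in> randomness k \<pi> \<rightarrow>\<^sub>M count_space UNIV" for n
    using countably_measurable_map[OF F, of ?stop n] by (simp add: countably_measurable_def)
  then have "T \<in> randomness k \<pi> \<rightarrow>\<^sub>M count_space UNIV"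
    unfolding T_def by (rule measurable_Least)
  then have "countably_measurable (randomness k \<pi>) (\<lambda>\<omega>. ?F (T \<omega>) \<omega>)"
    by (rule countably_measurable_bind[OF countably_measurable_countable F])
  then show ?thesis
  proof (rule countably_measurable_cong)
    fix \<omega> assume "\<omega> \<in> space (randomness k \<pi>)"
    moreover obtain r p where \<omega>: "\<omega> = (r, p)" by force
    ultimately have stop: "always_stops k \<pi> x r p" using stops by blast
    have "?stop (?F (T \<omega>) \<omega>)"
      using outcome_eq_round_robin(1)[OF stop] unfolding T_def \<omega> prod.case by (rule LeastI_ex)
    then show "?F (T \<omega>) \<omega> = (case \<omega> of (r, p) \<Rightarrow> outcome k \<pi> x r p)"
      using outcome_eq_round_robin(2)[OF stop] by (simp add: \<omega>)
  qed
qed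

lemma advance_cong_local:
  "x i = x' i \<Longrightarrow> r i = r' i \<Longrightarrow> advance \<pi> x r p c i = advance \<pi> x' r' p c i"
  by (simp add: advance_def)

lemma round_robin_cong:
  assumes "\<And>i. i \<in> J \<Longrightarrow> x i = x' i" "\<And>i. i \<in> J \<Longrightarrow> r i = r' i"
  shows "round_robin k \<pi> J x r p c n = round_robin k \<pi> J x' r' p c n"
proof -
  have "advance \<pi> x r p c i = advance \<pi> x' r' p c i" if "i \<in> J" for c i
    using that by (intro advance_cong_local assms)
  then have "sched_step \<pi> J x r p i c = sched_step \<pi> J x' r' p i c" for c i
    by (cases "i \<in> J") (simp_all add: sched_step_def)
  then show ?thesis by (induction n) simp_all
qed

text \<open>The sample space contains all functions from \<open>nat\<close> to \<open>bool\<close>.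
  Restriction reduces them to the finitely many members of \<open>inputs k\<close>, for which
  termination is known.\<close>

lemma outcome_restrict_inputs: "outcome k \<pi> (restrict x {1..k}) r p = outcome k \<pi> x r p"
proof -
  have adv: "advance \<pi> (restrict x {1..k}) r p c i = advance \<pi> x r p c i" if "i \<in> {1..k}" for c i
    using that by (intro advance_cong_local) auto
  have "execution k \<pi> (restrict x {1..k}) r p f = execution k \<pi> x r p f" for f
    unfolding execution_def by (simp only: adv cong: bex_cong)
  then show ?thesis by (simp add: outcome_def final_conf_def)
qed

lemma measurable_transcript:
  assumes \<pi>: "is_protocol k \<pi>"
    and stops: "\<And>x r p. x \<in> inputs k \<Longrightarrow> (r, p) \<in> space (randomness k \<pi>) \<Longrightarrow> always_stops k \<pi> x r p"
  shows "transcript k \<pi> i \<in> sample_space k \<pi> \<mu> \<rightarrow>\<^sub>M transcript_space k i"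
proof -
  have "countably_measurable (sample_space k \<pi> \<mu>) (\<lambda>s. restrict (fst s) {1..k})"
    unfolding countably_measurable_def
  proof
    show "(\<lambda>s. restrict (fst s) {1..k}) \<in> sample_space k \<pi> \<mu> \<rightarrow>\<^sub>M count_space UNIV"
      unfolding sample_space_def by (rule measurable_compose[OF measurable_fst]) simp
    have "finite (PiE {1..k} (\<lambda>_. UNIV :: bool set))" by (intro finite_PiE) auto
    then show "countable ((\<lambda>s. restrict (fst s) {1..k}) ` space (sample_space k \<pi> \<mu>))"
      by (intro countable_finite) (erule finite_subset[rotated], auto)
  qed
  \<comment> \<open>The default \<open>init_conf\<close> covers vectors outside
    \<open>inputs k\<close>; it is never attained once the restricted input is substituted for
    \<open>x\<close>.\<close>
  moreover have "countably_measurable (sample_space k \<pi> \<mu>)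
      (\<lambda>s. case snd s of (r, p) \<Rightarrow> if x \<in> inputs k then outcome k \<pi> x r p else init_conf)" for x
  proof (cases "x \<in> inputs k")
    case True
    have "snd \<in> sample_space k \<pi> \<mu> \<rightarrow>\<^sub>M randomness k \<pi>" by (simp add: sample_space_def)
    from countably_measurable_compose[OF this countably_measurable_outcome[OF \<pi> stops[OF True]]] True
    show ?thesis by simp
  qed (simp add: case_prod_unfold countably_measurable_const)
  ultimately have "countably_measurable (sample_space k \<pi> \<mu>) (\<lambda>s. case snd s of (r, p) \<Rightarrow>
      if restrict (fst s) {1..k} \<in> inputs k then outcome k \<pi> (restrict (fst s) {1..k}) r p else init_conf)"
    by (rule countably_measurable_bind)
  then have "countably_measurable (sample_space k \<pi> \<mu>) (\<lambda>(x, r, p). outcome k \<pi> x r p)"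
    unfolding outcome_restrict_inputs by (simp add: inputs_def case_prod_unfold)
  then have "countably_measurable (sample_space k \<pi> \<mu>) (\<lambda>s. h (case s of (x, r, p) \<Rightarrow> outcome k \<pi> x r p))"
    for h :: "conf \<Rightarrow> msg list \<times> msg list"
    by (rule countably_measurable_map)
  then have "(\<lambda>s. h (case s of (x, r, p) \<Rightarrow> outcome k \<pi> x r p)) \<in> sample_space k \<pi> \<mu> \<rightarrow>\<^sub>M count_space UNIV"
    for h :: "conf \<Rightarrow> msg list \<times> msg list"
    by (simp only: countably_measurable_def)
  from this[of "\<lambda>c. (sent (c i) j, rcvd (c i) j)" for j] show ?thesis
    unfolding transcript_def transcript_space_def case_prod_unfold
    by (intro measurable_restrict)
qed

section \<open>Guessing an input from a transcript\<close>

text \<open>Only the sent half of \<open>y\<close> enters. Player \<open>i\<close> is otherwise in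
  its initial state and stays there, because the simulating schedule leaves it out.\<close>

definition presend :: "nat \<Rightarrow> (nat \<Rightarrow> msg list \<times> msg list) \<Rightarrow> conf" where
  "presend i y = init_conf(i := (init_conf i)\<lparr>sent := (\<lambda>j. fst (y j))\<rparr>)"

lemma partial_run_stopped:
  assumes f: "partial_run \<pi> J x r p f" and "i \<in> J" "stopped (f m i)" "m \<le> n"
  shows "f n i = f m i"
  using assms(4)
proof (induction n rule: dec_induct)
  case (step n)
  then have "\<not> enabled (f n) i"
    using assms(3) by (auto simp: enabled_def stopped_def)
  then show ?case
    using f \<open>i \<in> J\<close> step.IH unfolding partial_run_def by metis
qed simp

lemma round_robin_idle:
  "i \<notin> J \<Longrightarrow> round_robin k \<pi> J x r p c n i = c i"
  by (induction n) (auto simp: sched_step_def)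

text \<open>Confluence with the simulation as the fair run and the genuine round robin as the run to
  be matched. The scheduled players use only their own inputs and strings, so the restrictions to
  \<open>J\<close> suffice.\<close>

lemma simulated_outcome:
  fixes i :: nat
  assumes stops: "always_stops k \<pi> x r p"
  defines "J \<equiv> {1..k} - {i}"
  assumes j: "j \<in> J"
  shows "\<exists>m. round_robin k \<pi> J (restrict x J) (restrict r J) p
           (presend i (transcript k \<pi> i (x, r, p))) m j = outcome k \<pi> x r p j"
proof -
  let ?y = "transcript k \<pi> i (x, r, p)"
  define g where "g = round_robin k \<pi> {1..k} x r p init_conf"
  obtain N where N: "\<forall>i\<in>{1..k}. stopped (g N i)"
    using outcome_eq_round_robin(1)[OF stops] unfolding g_def by blast
  have out: "outcome k \<pi> x r p = g N"
    using outcome_eq_round_robin(2)[OF stops] N unfolding g_def by blast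
  have ex: "execution k \<pi> x r p g" unfolding g_def by (rule execution_round_robin) simp
  have "\<exists>m. round_robin k \<pi> J x r p (presend i ?y) m j = g N j"
  proof (rule partial_run_local_states[where J = J and g = g])
    show "finite J" by (simp add: J_def)
    show "partial_run \<pi> J x r p (round_robin k \<pi> J x r p (presend i ?y))"
      by (rule partial_run_round_robin)
    show "fair_on J (round_robin k \<pi> J x r p (presend i ?y))"
      by (rule fair_on_round_robin) (auto simp: J_def)
    show "partial_run \<pi> J x r p g" using ex by (rule partial_run_execution)
    show "round_robin k \<pi> J x r p (presend i ?y) 0 i' = g 0 i'" if "i' \<in> J" for i'
      using that by (simp add: presend_def g_def J_def)
    show "prefix (sent (g n i') j') (sent (round_robin k \<pi> J x r p (presend i ?y) 0 i') j')"
      if "i' \<notin> J" "j' \<in> J" for n i' j'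
    \<comment> \<open>The only outside player is \<open>i\<close>: its sent list grows until
      \<open>N\<close> and is frozen afterwards, so it is always a prefix of the list in the
      transcript. Indices that are not players never send.\<close>
    proof (cases "i' \<in> {1..k}")
      case True
      with that have i': "i' = i" by (simp add: J_def)
      have "prefix (sent (g n i) j') (sent (g N i) j')"
      proof (cases "n \<le> N")
        case le: True
        then show ?thesis using execution_sent_mono[OF ex le, of i j'] by (auto simp: prefix_def)
      next
        case False
        then show ?thesis using execution_stopped[OF ex, of N i n] N True i' by simp
      qed
      then show ?thesis
        using that(2) by (simp add: i' presend_def transcript_def out J_def)
    next
      case False
      then show ?thesis
        using round_robin_idle[of i' "{1..k}" k \<pi> x r p init_conf n] by (simp add: g_def init_conf_def)
    qed
    show "j \<in> J" by (rule j)
  qed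
  then show ?thesis
    using round_robin_cong[of J "restrict x J" x "restrict r J" r] out by auto
qed

section \<open>Recovering one input bit from the parity\<close>

lemma Par_cong: "(\<And>j. j \<in> {1..k} \<Longrightarrow> x j = x' j) \<Longrightarrow> Par k x = Par k x'"
  by (induction k) auto

lemma Par_flip: "i \<in> {1..k} \<Longrightarrow> Par k x = (Par k (x(i := False)) \<noteq> x i)"
proof (induction k)
  case (Suc k)
  show ?case
  proof (cases "i = Suc k")
    case True
    then have "Par k (x(i := False)) = Par k x" by (intro Par_cong) auto
    moreover have "Par (Suc k) (x(i := False)) = Par k (x(i := False))"
      by (simp only: Par.simps True fun_upd_same) blast
    ultimately show ?thesis unfolding True by (simp only: Par.simps)
  next
    case False
    then have "Par k x = (Par k (x(i := False)) \<noteq> x i)" using Suc by (simp del: fun_upd_apply)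
    moreover have "(x(i := False)) (Suc k) = x (Suc k)" using False by simp
    ultimately show ?thesis unfolding Par.simps by blast
  qed
qed simp

text \<open>
  Runs the other players against the messages \<open>y\<close> of player \<open>i\<close>; the output of player \<open>1\<close> and the
  parity of the other inputs then determine \<open>x i\<close>.
\<close>

definition guess ::
  "nat \<Rightarrow> protocol \<Rightarrow> nat \<Rightarrow>
    (nat \<Rightarrow> msg list \<times> msg list) \<times> (nat \<Rightarrow> bool) \<times> (nat \<Rightarrow> rstr) \<times> rstr \<Rightarrow> bool" where
  "guess k \<pi> i = (\<lambda>(y, x, r, p). \<exists>n.
     status (round_robin k \<pi> ({1..k} - {i}) x r p (presend i y) n 1) = Stopped [\<not> Par k (x(i := False))])"

lemma guess_correct:
  assumes stops: "always_stops k \<pi> x r p" and i: "i \<in> {1..k}" "i \<noteq> 1"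
    and out: "status (outcome k \<pi> x r p 1) = Stopped [Par k x]"
  defines "J \<equiv> {1..k} - {i}"
  shows "guess k \<pi> i (transcript k \<pi> i (x, r, p), restrict x J, restrict r J, p) = x i"
proof -
  let ?f = "round_robin k \<pi> J (restrict x J) (restrict r J) p (presend i (transcript k \<pi> i (x, r, p)))"
  \<comment> \<open>Here \<open>i \<noteq> 1\<close> matters: the player whose output is inspected
    must be among the simulated ones.\<close>
  have 1: "1 \<in> J" using i by (auto simp: J_def)
  obtain m where m: "status (?f m 1) = Stopped [Par k x]"
    using simulated_outcome[OF stops, of 1 i] 1 out unfolding J_def by metis
  \<comment> \<open>A stopped player keeps its state, so the existential over times in
    \<open>guess\<close> cannot be satisfied by an output other than the one found at time
    \<open>m\<close>.\<close>
  have "w = [Par k x]" if "status (?f n 1) = Stopped w" for n w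
    using partial_run_stopped[OF partial_run_round_robin 1, of k \<pi> "restrict x J" "restrict r J" p
        "presend i (transcript k \<pi> i (x, r, p))" n m]
      partial_run_stopped[OF partial_run_round_robin 1, of k \<pi> "restrict x J" "restrict r J" p
        "presend i (transcript k \<pi> i (x, r, p))" m n] that m
    by (cases "m \<le> n") (auto simp: stopped_def)
  then have "(\<exists>n. status (?f n 1) = Stopped [b]) \<longleftrightarrow> b = Par k x" for b
    using m by blast
  moreover have "Par k ((restrict x J)(i := False)) = Par k (x(i := False))"
    by (rule Par_cong) (auto simp: J_def)
  ultimately have "guess k \<pi> i (transcript k \<pi> i (x, r, p), restrict x J, restrict r J, p) \<longleftrightarrow>
      (\<not> Par k (x(i := False))) = Par k x"
    by (simp only: guess_def prod.case J_def)
  then show ?thesis using Par_flip[OF i(1), of x] by blast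
qed

text \<open>For fixed messages \<open>y\<close> and inputs \<open>x\<close>, the guess is a
  countable disjunction over the times of a simulated run. As \<open>y\<close> and \<open>x\<close>
  range over countable sets, binding over them gives joint measurability.\<close>

lemma measurable_guess:
  assumes \<pi>: "is_protocol k \<pi>"
  shows "guess k \<pi> i \<in> transcript_space k i \<Otimes>\<^sub>M ((\<Pi>\<^sub>M j\<in>{1..k} - {i}. count_space UNIV) \<Otimes>\<^sub>M
           ((\<Pi>\<^sub>M j\<in>{1..k} - {i}. priv \<pi> j) \<Otimes>\<^sub>M pub \<pi>)) \<rightarrow>\<^sub>M count_space UNIV"
    (is "_ \<in> ?M \<rightarrow>\<^sub>M _")
proof -
  let ?J = "{1..k} - {i}"
  let ?R = "(\<Pi>\<^sub>M j\<in>?J. priv \<pi> j) \<Otimes>\<^sub>M pub \<pi>"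
  let ?g = "\<lambda>c x n (r, p). status (round_robin k \<pi> ?J x r p (presend i c) n 1)"
  have g: "countably_measurable ?R (?g y x n)" for y x n
    using countably_measurable_map[OF countably_measurable_round_robin[OF \<pi>, of ?J x "presend i y" n], of "\<lambda>c. status (c 1)"]
    by (simp add: case_prod_unfold)
  have "(\<lambda>\<omega>. \<exists>n. ?g y x n \<omega> = w) \<in> ?R \<rightarrow>\<^sub>M count_space UNIV" for y x w
    by (rule pred_intros_countable(2))
       (use countably_measurable_map[OF g, of "\<lambda>s. s = w"] in \<open>simp add: countably_measurable_def\<close>)
  then have "countably_measurable ?R (\<lambda>\<omega>. \<exists>n. ?g y x n \<omega> = w)" for y x w
    by (rule countably_measurable_countable)
  then have 1: "countably_measurable ?M (\<lambda>\<omega>. \<exists>n. ?g y x n (snd (snd \<omega>)) = w)" for y x w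
    by (rule countably_measurable_compose[rotated]) measurable
  have "fst \<in> ?M \<rightarrow>\<^sub>M (\<Pi>\<^sub>M j\<in>?J. count_space (UNIV :: (msg list \<times> msg list) set))"
    unfolding transcript_space_def by (rule measurable_fst)
  from countably_measurable_compose[OF this countably_measurable_PiM]
  have 2: "countably_measurable ?M fst" by simp
  have "(\<lambda>\<omega>. fst (snd \<omega>)) \<in> ?M \<rightarrow>\<^sub>M (\<Pi>\<^sub>M j\<in>?J. count_space (UNIV :: bool set))"
    by (rule measurable_compose[OF measurable_snd measurable_fst])
  from countably_measurable_compose[OF this countably_measurable_PiM]
  have "countably_measurable ?M (\<lambda>\<omega>. fst (snd \<omega>))" by simp
  with 2 have "countably_measurable ?M (\<lambda>\<omega>. (fst \<omega>, fst (snd \<omega>)))"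
    by (rule countably_measurable_pair)
  from countably_measurable_bind[OF this, of "\<lambda>(y, x) \<omega>. \<exists>n. ?g y x n (snd (snd \<omega>)) = Stopped [\<not> Par k (x(i := False))]"] 1
  have "countably_measurable ?M (\<lambda>\<omega>. \<exists>n. ?g (fst \<omega>) (fst (snd \<omega>)) n (snd (snd \<omega>)) =
      Stopped [\<not> Par k ((fst (snd \<omega>))(i := False))])"
    by (simp add: case_prod_unfold)
  then show ?thesis
    by (simp add: countably_measurable_def guess_def case_prod_unfold)
qed

section \<open>Uniform inputs as a product distribution\<close>

lemma pmf_of_set_Times:
  assumes "finite A" "A \<noteq> {}" "finite B" "B \<noteq> {}"
  shows "pmf_of_set (A \<times> B) = pair_pmf (pmf_of_set A) (pmf_of_set B)"
proof (rule pmf_eqI)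
  fix z :: "'a \<times> 'b"
  show "pmf (pmf_of_set (A \<times> B)) z = pmf (pair_pmf (pmf_of_set A) (pmf_of_set B)) z"
    using assms by (cases z) (simp add: pmf_pair indicator_def card_cartesian_product)
qed

text \<open>One identity supplies both distributional facts: \<open>x i\<close> is a fair coin, and
  it is independent of the remaining inputs.\<close>

lemma uniform_inputs_split:
  assumes "i \<in> {1..k}"
  defines "J \<equiv> {1..k} - {i}"
  shows "map_pmf (\<lambda>x. (x i, restrict x J)) (uniform_inputs k) =
           pair_pmf (pmf_of_set UNIV) (pmf_of_set (PiE J (\<lambda>_. UNIV)))"
proof -
  have I: "{1..k} = insert i J" "i \<notin> J" using assms by auto
  have fin: "finite (PiE J (\<lambda>_. UNIV :: bool set))" "PiE J (\<lambda>_. UNIV :: bool set) \<noteq> {}"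
    by (auto simp: J_def PiE_eq_empty_iff intro!: finite_PiE)
  have "map_pmf (\<lambda>x. (x i, restrict x J)) (uniform_inputs k) = pmf_of_set (UNIV \<times> PiE J (\<lambda>_. UNIV))"
    unfolding uniform_inputs_def inputs_def
  proof (rule map_pmf_of_set_bij_betw)
    show "bij_betw (\<lambda>x. (x i, restrict x J)) (PiE {1..k} (\<lambda>_. UNIV :: bool set)) (UNIV \<times> PiE J (\<lambda>_. UNIV))"
    proof (rule bij_betw_byWitness[where f' = "\<lambda>(b, z). z(i := b)"])
      show "\<forall>x\<in>PiE {1..k} (\<lambda>_. UNIV). (\<lambda>(b, z). z(i := b)) (x i, restrict x J) = x"
        using I by (simp add: fun_eq_iff PiE_iff extensional_def)
      show "\<forall>a\<in>UNIV \<times> PiE J (\<lambda>_. UNIV). (\<lambda>x. (x i, restrict x J)) ((\<lambda>(b, z). z(i := b)) a) = a"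
        using I(2) by (simp add: fun_eq_iff PiE_iff extensional_def)
      show "(\<lambda>(b, z). z(i := b)) ` (UNIV \<times> PiE J (\<lambda>_. UNIV)) \<subseteq> PiE {1..k} (\<lambda>_. UNIV :: bool set)"
        unfolding I(1) by (auto simp: PiE_iff extensional_def)
    qed auto
  qed (auto simp: PiE_eq_empty_iff intro!: finite_PiE)
  also have "\<dots> = pair_pmf (pmf_of_set UNIV) (pmf_of_set (PiE J (\<lambda>_. UNIV)))"
    using fin by (intro pmf_of_set_Times) auto
  finally show ?thesis .
qed

lemma pair_pmf_marginals:
  assumes "map_pmf (\<lambda>x. (f x, g x)) p = pair_pmf q q'"
  shows "map_pmf f p = q" "map_pmf g p = q'"
  using arg_cong[OF assms, of "map_pmf fst"] arg_cong[OF assms, of "map_pmf snd"]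
  by (simp_all add: map_pmf_comp map_fst_pair_pmf map_snd_pair_pmf)

section \<open>The lower bound\<close>

lemma prob_space_randomness:
  assumes "is_protocol k \<pi>"
  shows "prob_space (randomness k \<pi>)"
  unfolding randomness_def using assms
  by (intro prob_space_pair prob_space_PiM) (auto simp: is_protocol_def)

lemma prob_space_sample_space:
  assumes "is_protocol k \<pi>"
  shows "prob_space (sample_space k \<pi> \<mu>)"
  unfolding sample_space_def
  by (intro prob_space_pair prob_space_measure_pmf prob_space_randomness assms)

text \<open>The error bound holds for every fixed input. In each fiber the event that player
  \<open>1\<close> outputs the parity lies inside the event that the guess is right; averaging over
  the inputs by Fubini preserves the bound.\<close>

lemma prob_guess_correct:
  assumes \<pi>: "is_protocol k \<pi>" and comp: "eps_computes_Par k \<epsilon> \<pi>"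
    and i: "i \<in> {1..k}" "i \<noteq> 1" and "\<epsilon> \<le> 1"
  defines "J \<equiv> {1..k} - {i}" and "M \<equiv> sample_space k \<pi> (uniform_inputs k)"
  defines "W \<equiv> \<lambda>(x, r, p). (transcript k \<pi> i (x, r, p), restrict x J, restrict r J, p)"
  assumes meas: "{s \<in> space M. guess k \<pi> i (W s) = fst s i} \<in> sets M" (is "?D \<in> _")
  shows "1 - \<epsilon> \<le> measure M ?D"
proof -
  interpret R: prob_space "randomness k \<pi>" by (rule prob_space_randomness[OF \<pi>])
  interpret M: prob_space M unfolding M_def by (rule prob_space_sample_space[OF \<pi>])
  have fiber: "ennreal (1 - \<epsilon>) \<le> emeasure (randomness k \<pi>) (Pair x -` ?D)" if x: "x \<in> inputs k" for x
  proof -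
    let ?G = "{(r, p) \<in> space (randomness k \<pi>). status (outcome k \<pi> x r p 1) = Stopped [Par k x]}"
    have "1 - \<epsilon> \<le> measure (randomness k \<pi>) ?G"
      using comp x by (auto simp: eps_computes_Par_def)
    also have "\<dots> \<le> measure (randomness k \<pi>) (Pair x -` ?D)"
    proof (rule R.finite_measure_mono)
      show "Pair x -` ?D \<in> sets (randomness k \<pi>)"
        using meas unfolding M_def sample_space_def by (rule sets_Pair1)
      show "?G \<subseteq> Pair x -` ?D"
      proof safe
        fix r p assume rp: "(r, p) \<in> space (randomness k \<pi>)"
          "status (outcome k \<pi> x r p 1) = Stopped [Par k x]"
        have "always_stops k \<pi> x r p"
          using comp x rp(1) by (auto simp: eps_computes_Par_def)
        from guess_correct[OF this i rp(2)] rp(1) show "(r, p) \<in> Pair x -` ?D"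
          by (simp add: W_def J_def M_def sample_space_def space_pair_measure)
      qed
    qed
    finally show ?thesis by (simp add: R.emeasure_eq_measure)
  qed
  have "set_pmf (uniform_inputs k) = inputs k"
    unfolding uniform_inputs_def inputs_def
    by (intro set_pmf_of_set) (auto simp: PiE_eq_empty_iff intro!: finite_PiE)
  then have "(\<integral>\<^sup>+x. ennreal (1 - \<epsilon>) \<partial>measure_pmf (uniform_inputs k)) \<le>
      (\<integral>\<^sup>+x. emeasure (randomness k \<pi>) (Pair x -` ?D) \<partial>measure_pmf (uniform_inputs k))"
    by (intro nn_integral_mono_AE) (simp add: AE_measure_pmf_iff fiber del: vimage_Collect_eq)
  also have "\<dots> = emeasure M ?D"
    using meas unfolding M_def sample_space_def by (rule R.emeasure_pair_measure_alt[symmetric])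
  finally show ?thesis
    using \<open>\<epsilon> \<le> 1\<close> by (simp add: M.emeasure_eq_measure)
qed

theorem theorem4p1:
  fixes \<epsilon> :: real
  assumes "0 \<le> \<epsilon>" and "\<epsilon> < 1 / 2"
  shows "\<exists>c>0. \<forall>k\<ge>2. \<forall>\<pi>. is_protocol k \<pi> \<and> eps_computes_Par k \<epsilon> \<pi> \<longrightarrow>
           MIC k (uniform_inputs k) \<pi> \<ge> c * real k"
proof (intro exI[of _ "(1 - 2 * \<epsilon>)\<^sup>2 / 16"] conjI allI impI)
  show "0 < (1 - 2 * \<epsilon>)\<^sup>2 / 16" using assms by simp
  fix k :: nat and \<pi> :: protocol
  assume k: "2 \<le> k" and "is_protocol k \<pi> \<and> eps_computes_Par k \<epsilon> \<pi>"
  then have \<pi>: "is_protocol k \<pi>" and comp: "eps_computes_Par k \<epsilon> \<pi>" by auto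
  define \<mu> where "\<mu> = uniform_inputs k"
  define M where "M = sample_space k \<pi> \<mu>"
  interpret R: prob_space "randomness k \<pi>" by (rule prob_space_randomness[OF \<pi>])
  interpret M: prob_space M unfolding M_def by (rule prob_space_sample_space[OF \<pi>])
  have Y[measurable]: "transcript k \<pi> i \<in> M \<rightarrow>\<^sub>M transcript_space k i" for i
    unfolding M_def using comp by (intro measurable_transcript[OF \<pi>]) (auto simp: eps_computes_Par_def)
  define T1 where "T1 = (\<lambda>i. M.conditional_mutual_information 2
          (\<Pi>\<^sub>M j\<in>{1..k} - {i}. count_space UNIV)
          (transcript_space k i)
          (count_space UNIV \<Otimes>\<^sub>M (priv \<pi> i \<Otimes>\<^sub>M pub \<pi>))
          (\<lambda>(x, r, p). restrict x ({1..k} - {i}))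
          (transcript k \<pi> i)
          (\<lambda>(x, r, p). (x i, r i, p)))"
  define T2 where "T2 = (\<lambda>i. M.conditional_mutual_information 2
          (count_space UNIV)
          (transcript_space k i)
          ((\<Pi>\<^sub>M j\<in>{1..k} - {i}. count_space UNIV) \<Otimes>\<^sub>M ((\<Pi>\<^sub>M j\<in>{1..k} - {i}. priv \<pi> j) \<Otimes>\<^sub>M pub \<pi>))
          (\<lambda>(x, r, p). x i)
          (transcript k \<pi> i)
          (\<lambda>(x, r, p). (restrict x ({1..k} - {i}), restrict r ({1..k} - {i}), p)))"
  have MIC: "MIC k \<mu> \<pi> = (\<Sum>i\<in>{1..k}. T1 i + T2 i)"
    unfolding MIC_def T1_def T2_def M_def ..
  have T1: "0 \<le> T1 i" and T2: "0 \<le> T2 i" and T2': "i \<noteq> 1 \<Longrightarrow> (1 - 2 * \<epsilon>)\<^sup>2 / 8 \<le> T2 i"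
    if i: "i \<in> {1..k}" for i
  proof -
    define J where "J = {1..k} - {i}"
    let ?SX = "\<Pi>\<^sub>M j\<in>J. count_space (UNIV :: bool set)"
    let ?SR = "(\<Pi>\<^sub>M j\<in>J. priv \<pi> j) \<Otimes>\<^sub>M pub \<pi>"
    let ?X1 = "\<lambda>(x :: nat \<Rightarrow> bool, r :: nat \<Rightarrow> rstr, p :: rstr). restrict x J"
    let ?Z1 = "\<lambda>(x :: nat \<Rightarrow> bool, r :: nat \<Rightarrow> rstr, p :: rstr). (x i, r i, p)"
    let ?X2 = "\<lambda>(x :: nat \<Rightarrow> bool, r :: nat \<Rightarrow> rstr, p :: rstr). x i"
    let ?Z2 = "\<lambda>(x :: nat \<Rightarrow> bool, r :: nat \<Rightarrow> rstr, p :: rstr). (restrict x J, restrict r J, p)"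
    note split = uniform_inputs_split[OF i, folded J_def \<mu>_def]
    note marg = pair_pmf_marginals[OF split]
    have J: "J \<subseteq> {1..k}" by (auto simp: J_def)
    have [measurable]: "(\<lambda>(r, p). (r i, p)) \<in> randomness k \<pi> \<rightarrow>\<^sub>M priv \<pi> i \<Otimes>\<^sub>M pub \<pi>"
      unfolding randomness_def using i by measurable
    have [measurable]: "(\<lambda>(r, p). (restrict r J, p)) \<in> randomness k \<pi> \<rightarrow>\<^sub>M ?SR"
      unfolding randomness_def using measurable_restrict_subset[OF J, of "priv \<pi>"] by measurable
    have [measurable]: "(\<lambda>x. restrict x J) \<in> measure_pmf \<mu> \<rightarrow>\<^sub>M ?SX"
      by (auto simp: measurable_def space_PiM)
    have fst: "fst \<in> M \<rightarrow>\<^sub>M measure_pmf \<mu>" and snd: "snd \<in> M \<rightarrow>\<^sub>M randomness k \<pi>"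
      unfolding M_def sample_space_def by measurable
    have X1[measurable]: "?X1 \<in> M \<rightarrow>\<^sub>M ?SX"
      unfolding case_prod_unfold by (rule measurable_compose[OF fst]) measurable
    have X2[measurable]: "?X2 \<in> M \<rightarrow>\<^sub>M count_space UNIV"
      unfolding case_prod_unfold by (rule measurable_compose[OF fst]) simp
    have "(\<lambda>s. (\<lambda>(r, p). (r i, p)) (snd s)) \<in> M \<rightarrow>\<^sub>M priv \<pi> i \<Otimes>\<^sub>M pub \<pi>"
      by (rule measurable_compose[OF snd]) measurable
    from measurable_Pair[OF X2 this]
    have Z1[measurable]: "?Z1 \<in> M \<rightarrow>\<^sub>M count_space UNIV \<Otimes>\<^sub>M (priv \<pi> i \<Otimes>\<^sub>M pub \<pi>)"
      by (simp add: case_prod_unfold)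
    have "(\<lambda>s. (\<lambda>(r, p). (restrict r J, p)) (snd s)) \<in> M \<rightarrow>\<^sub>M ?SR"
      by (rule measurable_compose[OF snd]) measurable
    from measurable_Pair[OF X1 this]
    have Z2[measurable]: "?Z2 \<in> M \<rightarrow>\<^sub>M ?SX \<Otimes>\<^sub>M ?SR"
      by (simp add: case_prod_unfold)
    \<comment> \<open>\<open>conditional_mutual_information\<close> is the difference
      \<open>I(X; (Y, Z)) - I(X; Z)\<close>. Independence removes the second term here and in
      \<open>Z2_0\<close>, leaving plain mutual informations with the pair of transcript and
      condition.\<close>
    have "M.mutual_information 2 ?SX (count_space UNIV \<Otimes>\<^sub>M (priv \<pi> i \<Otimes>\<^sub>M pub \<pi>))
        (\<lambda>(x, \<omega>). restrict x J) (\<lambda>(x, \<omega>). (x i, (\<lambda>(r, p). (r i, p)) \<omega>)) = 0"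
      unfolding M_def sample_space_def
    proof (rule mutual_information_independent[OF R.prob_space_axioms])
      have "map_pmf (\<lambda>x. (restrict x J, x i)) \<mu> = map_pmf (\<lambda>(a, b). (b, a)) (map_pmf (\<lambda>x. (x i, restrict x J)) \<mu>)"
        by (simp add: map_pmf_comp)
      also have "\<dots> = pair_pmf (map_pmf (\<lambda>x. restrict x J) \<mu>) (map_pmf (\<lambda>x. x i) \<mu>)"
        unfolding split marg by (rule pair_commute_pmf[symmetric])
      finally show "map_pmf (\<lambda>x. (restrict x J, x i)) \<mu> = \<dots>" .
    qed (auto simp: space_PiM)
    then have Z1_0: "M.mutual_information 2 ?SX (count_space UNIV \<Otimes>\<^sub>M (priv \<pi> i \<Otimes>\<^sub>M pub \<pi>)) ?X1 ?Z1 = 0"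
      by (simp add: case_prod_unfold)
    have "M.mutual_information 2 (count_space UNIV) (?SX \<Otimes>\<^sub>M ?SR)
        (\<lambda>(x, \<omega>). x i) (\<lambda>(x, \<omega>). (restrict x J, (\<lambda>(r, p). (restrict r J, p)) \<omega>)) = 0"
      unfolding M_def sample_space_def
      by (rule mutual_information_independent[OF R.prob_space_axioms])
         (auto simp: space_PiM split marg)
    then have Z2_0: "M.mutual_information 2 (count_space UNIV) (?SX \<Otimes>\<^sub>M ?SR) ?X2 ?Z2 = 0"
      by (simp add: case_prod_unfold)
    show "0 \<le> T1 i"
      unfolding T1_def M.conditional_mutual_information_def J_def[symmetric] Z1_0
      by (simp, rule M.mutual_information_nonneg) (simp, measurable)
    let ?W = "\<lambda>s. (transcript k \<pi> i s, ?Z2 s)"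
    have T2_eq: "T2 i = M.mutual_information 2 (count_space UNIV) (transcript_space k i \<Otimes>\<^sub>M (?SX \<Otimes>\<^sub>M ?SR)) ?X2 ?W"
      unfolding T2_def M.conditional_mutual_information_def J_def[symmetric] Z2_0 by simp
    show "0 \<le> T2 i"
      unfolding T2_eq by (rule M.mutual_information_nonneg) (simp, measurable)
    assume "i \<noteq> 1"
    show "(1 - 2 * \<epsilon>)\<^sup>2 / 8 \<le> T2 i"
      unfolding T2_eq
    proof (rule M.mutual_information_bit_ge[where h = "guess k \<pi> i"])
      have g[measurable]: "guess k \<pi> i \<in> transcript_space k i \<Otimes>\<^sub>M (?SX \<Otimes>\<^sub>M ?SR) \<rightarrow>\<^sub>M count_space UNIV"
        unfolding J_def by (rule measurable_guess[OF \<pi>])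
      show "guess k \<pi> i \<in> transcript_space k i \<Otimes>\<^sub>M (?SX \<Otimes>\<^sub>M ?SR) \<rightarrow>\<^sub>M count_space UNIV" by (rule g)
      \<comment> \<open>The law of the bit is computed in two projections, first to the inputs and
        then to coordinate \<open>i\<close>, whose marginal is uniform.\<close>
      show "distr M (count_space UNIV) ?X2 = measure_pmf (bernoulli_pmf (1 / 2))"
      proof -
        have "distr M (count_space UNIV) ?X2 = distr (distr M (measure_pmf \<mu>) fst) (count_space UNIV) (\<lambda>x. x i)"
          unfolding M_def sample_space_def by (subst distr_distr) (auto simp: comp_def case_prod_unfold)
        also have "distr M (measure_pmf \<mu>) fst = measure_pmf \<mu>"
          unfolding M_def sample_space_def by (rule R.distr_pair_fst)
        also have "distr (measure_pmf \<mu>) (count_space UNIV) (\<lambda>x. x i) = measure_pmf (map_pmf (\<lambda>x. x i) \<mu>)"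
          by (rule map_pmf_rep_eq[symmetric])
        finally show ?thesis by (simp only: marg bernoulli_pmf_half_conv_pmf_of_set)
      qed
      have "{s \<in> space M. guess k \<pi> i (?W s) = ?X2 s} \<in> sets M"
        by measurable
      then show "1 - \<epsilon> \<le> M.prob {s \<in> space M. guess k \<pi> i (?W s) = ?X2 s}"
        using prob_guess_correct[OF \<pi> comp i \<open>i \<noteq> 1\<close>] assms
        by (simp add: M_def \<mu>_def J_def case_prod_unfold)
    qed (use assms in auto)
  qed
  \<comment> \<open>Only the \<open>k - 1\<close> players other than \<open>1\<close> get the bound
    with 1/8. Since \<open>k >= 2\<close> gives \<open>k - 1 >= k/2\<close>, halving the constant
    yields a multiple of \<open>k\<close>.\<close>
  have "(1 - 2 * \<epsilon>)\<^sup>2 / 16 * real k \<le> (1 - 2 * \<epsilon>)\<^sup>2 / 8 * real (k - 1)"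
  proof -
    have "real k \<le> 2 * real (k - 1)" using k by simp
    from mult_left_mono[OF this, of "(1 - 2 * \<epsilon>)\<^sup>2 / 16"] show ?thesis by (simp add: ac_simps)
  qed
  also have "\<dots> = (\<Sum>i\<in>{2..k}. (1 - 2 * \<epsilon>)\<^sup>2 / 8)"
    using k by simp
  also have "\<dots> \<le> (\<Sum>i\<in>{2..k}. T1 i + T2 i)"
  proof (rule sum_mono)
    fix i assume "i \<in> {2..k}"
    then have "i \<in> {1..k}" "i \<noteq> 1" by auto
    then show "(1 - 2 * \<epsilon>)\<^sup>2 / 8 \<le> T1 i + T2 i" using T1[of i] T2'[of i] by linarith
  qed
  also have "\<dots> \<le> (\<Sum>i\<in>{1..k}. T1 i + T2 i)"
    using T1 T2 by (intro sum_mono2) (auto intro: add_nonneg_nonneg)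
  finally show "(1 - 2 * \<epsilon>)\<^sup>2 / 16 * real k \<le> MIC k (uniform_inputs k) \<pi>"
    unfolding MIC[unfolded \<mu>_def] .
qed

end
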